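(* The prime number theorem holds, i.e. $$\frac{1}{N}\sum_{n\le N}\Lambda(n) = 1+o_{N\to\infty}(1),$$ that is, $\lim_{N\to\infty}\frac1N\sum_{n\le N}\Lambda(n)=1$.
   Context: $\Lambda$ denotes the von Mangoldt function: $\Lambda(n)=\log p$ if $n=p^a$ for a prime $p$ and an integer $a\ge 1$, and $\Lambda(n)=0$ otherwise. Sums over $n\le N$ run over positive integers $n$. *)

theory Defs
  imports Complex_Main "HOL-Number_Theory.Prime_Powers"
begin

end

theory Submission
  imports Defs "HOL-Complex_Analysis.Complex_Analysis"
begin

text \<open>The proof is Newman's. Let \<open>\<psi>(n) = \<Sum>k\<le>n. \<Lambda>(k)\<close>. Chebyshev's bound \<open>\<psi>(n) = O(n)\<close> makes the
  coefficients \<open>(\<psi>(n) - n) / n\<close> bounded, and summation by parts expresses their Dirichlet series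
  through \<open>-\<zeta>'(s)/\<zeta>(s) - \<zeta>(s)\<close>, which is holomorphic on a neighbourhood of \<open>Re s \<ge> 1\<close> because \<open>\<zeta>\<close> has no
  zeros on that half-plane. Newman's Tauberian theorem then gives the convergence of
  \<open>\<Sum> (\<psi>(n) - n) / n\<^sup>2\<close>, and since \<open>\<psi>\<close> is monotone this forces \<open>\<psi>(n) / n \<longlonglongrightarrow> 1\<close>.\<close>

section \<open>The zeta function to the right of the imaginary axis\<close>

text \<open>Newman's theorem needs bounded coefficients, and \<open>mangoldt n - 1\<close> is not
  bounded. Summing to \<open>psi\<close> and dividing by \<open>n\<close> makes it so, at the cost
  of Chebyshev's bound and of a partial summation that leaves error terms. The differences
  \<open>tele\<close> that continue zeta also describe these errors, so one convergence lemma serves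
  both continuations.

  Zeta has a pole at 1, so the argument runs on the continuation of (s - 1) zeta(s), which is
  holomorphic and equals 1 there. Its zeros are detected from the right: near s the von Mangoldt
  series grows like -k / e at s + e when k is the order of the zero (plus 1 / e when s = 1). On Re s
  > 1 absolute convergence excludes such growth; on the line Re s = 1 the positivity of Lambda does.

  Only an open neighbourhood of Re s >= 1 is available for the continuation, and its width may
  shrink as the height grows. Hence the width of the left detour may depend on the radius R of the
  contour, and N tends to infinity with both held fixed.\<close>

lemma norm_of_real_powr_diff_le:
  fixes s :: complex and a b :: real
  assumes "0 < a" "a \<le> b" "Re s \<ge> -1"
  shows "norm (of_real b powr (-s) - of_real a powr (-s)) \<le> norm s * a powr (- Re s - 1) * (b - a)"
proof -
  let ?S = "closed_segment (complex_of_real a) (of_real b)"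
  have "norm (of_real b powr (-s) - of_real a powr (-s))
          \<le> (norm s * a powr (- Re s - 1)) * norm (complex_of_real b - of_real a)"
  proof (rule field_differentiable_bound[of ?S "\<lambda>z. z powr (-s)" "\<lambda>z. (-s) * z powr (-s - 1)"])
    fix z assume "z \<in> ?S"
    then obtain u where u: "z = of_real u" "a \<le> u" "u \<le> b"
      using assms by (auto simp: closed_segment_of_real closed_segment_eq_real_ivl)
    then have "u > 0" using assms by linarith
    then show "((\<lambda>z. z powr (-s)) has_field_derivative (-s) * z powr (-s - 1)) (at z within ?S)"
      using u by (intro has_field_derivative_at_within[OF has_field_derivative_powr]) auto
    have "norm (z powr (-s - 1)) = u powr (- Re s - 1)"
      using u \<open>u > 0\<close> by (simp add: norm_powr_real_powr)
    also have "\<dots> \<le> a powr (- Re s - 1)"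
      using assms u by (intro powr_mono2') auto
    finally show "norm ((-s) * z powr (-s - 1)) \<le> norm s * a powr (- Re s - 1)"
      by (simp add: norm_mult mult_left_mono)
  qed auto
  also have "norm (complex_of_real b - of_real a) = b - a"
    using assms by (metis abs_of_nonneg diff_ge_0_iff_ge norm_of_real of_real_diff)
  finally show ?thesis .
qed

text \<open>\<open>tele s n\<close> is \<open>(s - 1)\<close> times the difference between \<open>n\<^sup>-\<^sup>s\<close> and the integral of \<open>x\<^sup>-\<^sup>s\<close>
  over \<open>[n, n + 1]\<close>. The sum of the powers telescopes, so \<open>\<Sum>n. tele s n\<close> continues
  \<open>(s - 1) \<zeta>(s)\<close> to \<open>Re s > 0\<close>. Since \<open>0 powr z = 0\<close>, the term for \<open>n = 0\<close> contributes the constant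
  \<open>1\<close>, and in the Dirichlet series below, which are indexed from \<open>0\<close>, it contributes nothing.\<close>

definition tele :: "complex \<Rightarrow> nat \<Rightarrow> complex" where
  "tele s n = (s - 1) * of_nat n powr (-s) - of_nat n powr (1 - s) + of_nat (Suc n) powr (1 - s)"

text \<open>The mean value inequality is used twice. The linear term of \<open>?f\<close> is chosen
  so that the derivative vanishes at \<open>z = n\<close>; it is therefore itself a difference of
  powers over a distance of at most 1, which gains the extra factor \<open>1 / n\<close>.\<close>

lemma norm_tele_le:
  assumes "n > 0" "Re s \<ge> -1"
  shows "norm (tele s n) \<le> norm (s - 1) * norm s * real n powr (- Re s - 1)"
proof -
  let ?S = "closed_segment (of_nat n) (of_nat (Suc n) :: complex)"
  let ?f = "\<lambda>z. (s - 1) * of_nat n powr (-s) * z + z powr (1 - s)"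
  have "norm (?f (of_nat (Suc n)) - ?f (of_nat n))
          \<le> (norm (s - 1) * norm s * real n powr (- Re s - 1)) * norm (of_nat (Suc n) - of_nat n :: complex)"
  proof (rule field_differentiable_bound[of ?S ?f "\<lambda>z. (s - 1) * (of_nat n powr (-s) - z powr (-s))"])
    fix z assume "z \<in> ?S"
    then have "z \<in> closed_segment (of_real (real n)) (of_real (real (Suc n)))" by simp
    then obtain u where u: "z = of_real u" "real n \<le> u" "u \<le> real (Suc n)"
      unfolding closed_segment_of_real by (auto simp: closed_segment_eq_real_ivl)
    then have "u > 0" using assms by (metis less_le_trans of_nat_0_less_iff)
    then have "(?f has_field_derivative
        (s - 1) * of_nat n powr (-s) * 1 + (1 - s) * z powr (1 - s - 1)) (at z within ?S)"
      using u by (intro DERIV_add DERIV_cmult has_field_derivative_at_within[OF has_field_derivative_powr]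
          DERIV_ident) auto
    then show "(?f has_field_derivative (s - 1) * (of_nat n powr (-s) - z powr (-s))) (at z within ?S)"
      by (simp add: algebra_simps)
    have "norm (of_real u powr (-s) - of_real (real n) powr (-s))
            \<le> norm s * real n powr (- Re s - 1) * (u - real n)"
      using assms u by (intro norm_of_real_powr_diff_le) auto
    also have "\<dots> \<le> norm s * real n powr (- Re s - 1) * 1"
      using u by (intro mult_left_mono) auto
    finally show "norm ((s - 1) * (of_nat n powr (-s) - z powr (-s)))
            \<le> norm (s - 1) * norm s * real n powr (- Re s - 1)"
      unfolding norm_mult u(1) by (simp add: norm_minus_commute mult_left_mono mult.assoc)
  qed auto
  also have "?f (of_nat (Suc n)) - ?f (of_nat n) = tele s n"
    by (simp add: tele_def algebra_simps)
  finally show ?thesis by simp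
qed

text \<open>The weights allow two uses: \<open>b n = 1\<close> with \<open>j = 0\<close> for zeta,
  and \<open>b n = psi n - n\<close> with \<open>j = 1\<close> for the errors of the partial
  summation. Each weighted term is of size \<open>n powr (j - Re s - 1)\<close>, up to a factor that
  is locally bounded in \<open>s\<close>.\<close>

lemma tele_sums:
  assumes b: "\<And>n. n > 0 \<Longrightarrow> norm (b n) \<le> C * real n powr j" and j: "j \<ge> 0"
  shows "(\<lambda>s. \<Sum>n. b n * tele s n) holomorphic_on {s. Re s > j}" (is ?th1)
    and "Re s > j \<Longrightarrow> summable (\<lambda>n. b n * tele s n)"
proof -
  have C: "C \<ge> 0" using b[of 1] order_trans[OF norm_ge_zero] by fastforce
  have key: "\<exists>d>0. cball s d \<subseteq> {s. Re s > j} \<and>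
      uniform_limit (cball s d) (\<lambda>N s. \<Sum>n<N. b n * tele s n) (\<lambda>s. \<Sum>n. b n * tele s n) sequentially"
    if s: "Re s > j" for s
  proof -
    \<comment> \<open>Half the distance to the boundary line: the ball keeps
      \<open>Re z \<ge> j + d\<close>, which leaves the convergent majorant
      \<open>n powr (- (1 + d))\<close>.\<close>
    define d where "d = (Re s - j) / 2"
    have d: "d > 0" using s by (simp add: d_def)
    have re: "Re z \<ge> j + d" if "z \<in> cball s d" for z
      using that abs_Re_le_cmod[of "s - z"] unfolding d_def mem_cball dist_norm by (simp add: field_simps)
    let ?K = "norm s + d + 1"
    have nz: "norm z \<le> norm s + d" if "z \<in> cball s d" for z
      using that norm_triangle_sub[of z s] by (auto simp: dist_norm norm_minus_commute)
    have bound: "norm (b n * tele z n) \<le> (C * ?K * ?K) * real n powr (- (1 + d))"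
      if n: "n > 0" and z: "z \<in> cball s d" for n z
    proof -
      have "norm (tele z n) \<le> norm (z - 1) * norm z * real n powr (- Re z - 1)"
        using n re[OF z] d j by (intro norm_tele_le) auto
      also have "\<dots> \<le> ?K * ?K * real n powr (- (j + d) - 1)"
        using nz[OF z] norm_triangle_ineq4[of z 1] re[OF z] n d
        by (intro mult_mono powr_mono) (auto intro: add_nonneg_nonneg)
      finally have 1: "norm (tele z n) \<le> ?K * ?K * real n powr (- (j + d) - 1)" .
      have "norm (b n * tele z n) \<le> (C * real n powr j) * (?K * ?K * real n powr (- (j + d) - 1))"
        unfolding norm_mult using b[OF n] 1 C by (intro mult_mono) auto
      also have "\<dots> = (C * ?K * ?K) * (real n powr j * real n powr (- (j + d) - 1))"
        by (simp add: mult_ac)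
      also have "real n powr j * real n powr (- (j + d) - 1) = real n powr (- (1 + d))"
        using n by (simp add: algebra_simps flip: powr_add)
      finally show ?thesis .
    qed
    have "uniform_limit (cball s d) (\<lambda>N s. \<Sum>n<N. b n * tele s n) (\<lambda>s. \<Sum>n. b n * tele s n) sequentially"
      using bound d
      by (intro Weierstrass_m_test_ev[of _ _ "\<lambda>n. (C * ?K * ?K) * real n powr (- (1 + d))"]
          eventually_mono[OF eventually_gt_at_top[of 0]] summable_mult)
         (auto simp: summable_real_powr_iff)
    moreover have "cball s d \<subseteq> {s. Re s > j}" using re d by fastforce
    ultimately show ?thesis using d by blast
  qed
  show ?th1
  proof (rule holomorphic_uniform_sequence)
    show "open {s. Re s > j}" by (simp add: open_halfspace_Re_gt)
    show "(\<lambda>s. \<Sum>n<N. b n * tele s n) holomorphic_on {s. Re s > j}" for N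
      unfolding tele_def by (intro holomorphic_intros)
  qed (use key in auto)
  show "summable (\<lambda>n. b n * tele s n)" if "Re s > j"
    using key[OF that] centre_in_cball[of s]
    by (auto simp: summable_iff_convergent convergent_def dest!: tendsto_uniform_limitI[of _ _ _ _ s] intro!: exI)
qed

lemma norm_nat_powr: "norm (of_nat n powr s :: complex) = real n powr Re s"
  by (simp add: norm_powr_real_powr)

lemma summable_nat_powr:
  assumes "Re s > 1"
  shows "summable (\<lambda>n. norm (of_nat n powr (-s) :: complex))"
  using assms by (simp add: norm_nat_powr summable_real_powr_iff)

section \<open>Zeta, its regularised continuation and its derivative\<close>

definition zeta :: "complex \<Rightarrow> complex" where
  "zeta s = (\<Sum>n. of_nat n powr (-s))"

definition Zeta_reg :: "complex \<Rightarrow> complex" where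
  "Zeta_reg s = (\<Sum>n. tele s n)"

lemma holomorphic_Zeta_reg: "Zeta_reg holomorphic_on {s. Re s > 0}"
  using tele_sums(1)[of "\<lambda>_. 1" 1 0] unfolding Zeta_reg_def[abs_def] by simp

text \<open>This value is the residue of zeta at its simple pole. It also shows that
  \<open>Zeta_reg\<close> is not identically zero.\<close>

lemma Zeta_reg_1 [simp]: "Zeta_reg 1 = 1"
proof -
  have "tele 1 n = (if n = 0 then 1 else 0)" for n
    by (auto simp: tele_def simp del: of_nat_Suc)
  then show ?thesis
    using sums_If_finite_set[of "{0}" "\<lambda>_. 1::complex"] by (simp add: Zeta_reg_def sums_iff)
qed

lemma Zeta_reg_eq:
  assumes s: "Re s > 1"
  shows "Zeta_reg s = (s - 1) * zeta s"
proof -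
  have "(\<lambda>n. real n powr (1 - Re s)) \<longlonglongrightarrow> 0"
    using s by (intro tendsto_neg_powr filterlim_real_sequentially) auto
  then have "(\<lambda>n. of_nat n powr (1 - s) :: complex) \<longlonglongrightarrow> 0"
    by (intro tendsto_norm_zero_cancel[where f="\<lambda>n. of_nat n powr (1 - s)"]) (simp add: norm_nat_powr)
  \<comment> \<open>The telescoped sum is its limit 0 minus its initial value, and that value is
    \<open>0 powr (1 - s) = 0\<close>.\<close>
  from telescope_sums[OF this]
  have "(\<lambda>n. of_nat (Suc n) powr (1 - s) - of_nat n powr (1 - s) :: complex) sums 0"
    by simp
  moreover have "(\<lambda>n. (s - 1) * of_nat n powr (-s)) sums ((s - 1) * zeta s)"
    unfolding zeta_def
    by (intro sums_mult summable_sums summable_norm_cancel[OF summable_nat_powr] s)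
  ultimately have "(\<lambda>n. (of_nat (Suc n) powr (1 - s) - of_nat n powr (1 - s)) + (s - 1) * of_nat n powr (-s)) sums (0 + (s - 1) * zeta s)"
    by (rule sums_add)
  then show ?thesis
    by (simp add: Zeta_reg_def tele_def sums_iff algebra_simps)
qed

lemma summable_ln_powr:
  assumes "c > 1"
  shows "summable (\<lambda>n. ln (real n) * real n powr (-c))"
proof (rule summable_comparison_test_ev)
  \<comment> \<open>Half of the excess of \<open>c\<close> over 1 pays for the logarithm through
    \<open>ln n \<le> n powr e / e\<close>; the other half keeps the series convergent.\<close>
  define e where "e = (c - 1) / 2"
  have e: "e > 0" "c - e > 1" using assms by (simp_all add: e_def field_simps)
  show "eventually (\<lambda>n. norm (ln (real n) * real n powr (-c)) \<le> (1 / e) * real n powr (- (c - e))) sequentially"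
    using eventually_ge_at_top[of 1]
  proof eventually_elim
    case (elim n)
    then have "ln (real n) * real n powr (-c) \<le> real n powr e / e * real n powr (-c)"
      using e by (intro mult_right_mono ln_powr_bound) auto
    also have "\<dots> = (1 / e) * real n powr (- (c - e))"
      by (simp add: field_simps flip: powr_add)
    finally show ?case using elim by (simp add: abs_mult)
  qed
  show "summable (\<lambda>n. (1 / e) * real n powr (- (c - e)))"
    using e by (intro summable_mult) (auto simp: summable_real_powr_iff)
qed

lemma zeta_has_derivative:
  assumes s: "Re s > 1"
  shows "(zeta has_field_derivative - (\<Sum>n. of_real (ln (real n)) * of_nat n powr (-s))) (at s)"
proof -
  define c where "c = (1 + Re s) / 2"
  have c: "c > 1" "Re s > c" using s by (simp_all add: c_def field_simps)
  let ?S = "{z. Re z > c}"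
  have op: "open ?S" by (simp add: open_halfspace_Re_gt)
  have nb: "norm (- (of_real (ln (real n)) * of_nat n powr (-z)) :: complex) \<le> ln (real n) * real n powr (-c)"
    if "z \<in> ?S" for n z
  proof (cases "n = 0")
    case False
    then show ?thesis
      using that by (auto simp: norm_mult norm_nat_powr intro!: mult_left_mono powr_mono)
  qed auto
  have "((\<lambda>z. \<Sum>n. of_nat n powr (-z)) has_field_derivative
      (\<Sum>n. - (of_real (ln (real n)) * of_nat n powr (-s)))) (at s)"
  proof (rule has_field_derivative_series'(2)[of ?S _ _ s])
    show "convex ?S" by (simp add: convex_halfspace_Re_gt)
    show "((\<lambda>z. of_nat n powr (-z)) has_field_derivative - (of_real (ln (real n)) * of_nat n powr (-z))) (at z within ?S)"
      for n and z :: complex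
    proof (cases "n = 0")
      case False
      then have "((\<lambda>z. of_nat n powr (-z)) has_field_derivative (Ln (of_nat n) * of_nat n powr (-z)) * (-1)) (at z)"
        by (intro DERIV_chain2[OF has_field_derivative_powr_right] DERIV_minus DERIV_ident) auto
      with False show ?thesis
        by (simp add: Ln_of_nat has_field_derivative_at_within)
    qed auto
    show "uniformly_convergent_on ?S (\<lambda>N z. \<Sum>n<N. - (of_real (ln (real n)) * of_nat n powr (-z)) :: complex)"
      by (rule Weierstrass_m_test'[OF nb summable_ln_powr[OF c(1)]])
    show "summable (\<lambda>n. of_nat n powr (-s) :: complex)"
      by (intro summable_norm_cancel[OF summable_nat_powr] s)
  qed (use c op in \<open>auto simp: interior_open\<close>)
  moreover have "summable (\<lambda>n. of_real (ln (real n)) * of_nat n powr (-s) :: complex)"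
    using nb[of s] c
    by (intro summable_comparison_test'[OF summable_ln_powr[OF c(1)], of 0]) auto
  ultimately show ?thesis
    by (simp add: suminf_minus zeta_def[abs_def])
qed

section \<open>The Dirichlet series of the von Mangoldt function\<close>

definition Mangoldt_series :: "complex \<Rightarrow> complex" where
  "Mangoldt_series s = (\<Sum>n. mangoldt n * of_nat n powr (-s))"

lemma norm_mangoldt_powr_le:
  "norm (mangoldt n * of_nat n powr (-s) :: complex) \<le> ln (real n) * real n powr (- Re s)"
proof (cases "n = 0")
  case False
  then show ?thesis
    using mangoldt_le[of n] by (auto simp: norm_mult norm_nat_powr intro!: mult_right_mono)
qed auto

lemma summable_mangoldt:
  assumes "Re s > 1"
  shows "summable (\<lambda>n. norm (mangoldt n * of_nat n powr (-s) :: complex))"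
  by (rule summable_comparison_test'[OF summable_ln_powr[OF assms], of 0])
     (use norm_mangoldt_powr_le in auto)

text \<open>Dirichlet convolution: collecting the pairs with product \<open>n\<close> turns the
  coefficient into the sum of Lambda over the divisors of \<open>n\<close>, which is
  \<open>ln n\<close>. Together with the derivative of zeta this identifies the series as
  -zeta'/zeta.\<close>

lemma Mangoldt_series_mult_zeta:
  assumes s: "Re s > 1"
  shows "Mangoldt_series s * zeta s = (\<Sum>n. of_real (ln (real n)) * of_nat n powr (-s))"
proof -
  let ?F = "\<lambda>n. mangoldt n * of_nat n powr (-s) :: complex" and ?E = "\<lambda>n. of_nat n powr (-s) :: complex"
  have F: "(?F has_sum Mangoldt_series s) UNIV" unfolding Mangoldt_series_def
    by (intro norm_summable_imp_has_sum summable_mangoldt s summable_sums summable_norm_cancel[OF summable_mangoldt])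
  have E: "(?E has_sum zeta s) UNIV" unfolding zeta_def
    by (intro norm_summable_imp_has_sum summable_nat_powr s summable_sums summable_norm_cancel[OF summable_nat_powr])
  have abs: "(\<lambda>n. norm (?F n)) summable_on UNIV" "(\<lambda>n. norm (?E n)) summable_on UNIV"
    using F E summable_on_iff_abs_summable_on_complex[of ?F] summable_on_iff_abs_summable_on_complex[of ?E]
    by (auto simp: has_sum_iff)
  have "(\<lambda>p. norm (case p of (d, m) \<Rightarrow> ?F d * ?E m)) summable_on UNIV \<times> UNIV"
    using abs unfolding Infinite_Sum.abs_summable_on_Sigma_iff
    by (simp add: norm_mult infsum_cmult_right' summable_on_cmult_right summable_on_cmult_left infsum_nonneg abs_mult)
  then have "(\<lambda>(d, m). ?F d * ?E m) summable_on UNIV \<times> UNIV"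
    by (rule abs_summable_summable)
  then have "((\<lambda>(d, m). ?F d * ?E m) has_sum (Mangoldt_series s * zeta s)) (UNIV \<times> UNIV)"
    using has_sum_cmult_right[OF E] has_sum_cmult_left[OF F]
    by (intro has_sum_SigmaI[where g = "\<lambda>d. ?F d * zeta s"]) auto
  \<comment> \<open>Terms with a zero index vanish. Dropping them makes
    \<open>(d, m) \<mapsto> (d * m, d)\<close> a bijection onto the pairs of a positive integer and
    one of its divisors.\<close>
  also have "?this \<longleftrightarrow> ((\<lambda>(d, m). ?F d * ?E m) has_sum (Mangoldt_series s * zeta s)) ({0<..} \<times> {0<..})"
    by (rule has_sum_cong_neutral) auto
  also have "\<dots> \<longleftrightarrow> ((\<lambda>(n, d). mangoldt d * ?E n) has_sum (Mangoldt_series s * zeta s))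
      (SIGMA n:{0<..}. {d. d dvd n})"
    by (rule has_sum_reindex_bij_witness[of _ "\<lambda>(n, d). (d, n div d)" "\<lambda>(d, m). (d * m, d)"])
       (auto simp: powr_times_real dvd_div_eq_0_iff intro!: Nat.gr0I)
  finally have "((\<lambda>(n, d). mangoldt d * ?E n) has_sum (Mangoldt_series s * zeta s))
      (SIGMA n:{0<..}. {d. d dvd n})" .
  then have "((\<lambda>n. \<Sum>d | d dvd n. mangoldt d * ?E n) has_sum (Mangoldt_series s * zeta s)) {0<..}"
    by (rule has_sum_SigmaD) (auto intro!: has_sum_finiteI)
  also have "?this \<longleftrightarrow> ((\<lambda>n. of_real (ln (real n)) * of_nat n powr (-s)) has_sum (Mangoldt_series s * zeta s)) UNIV"
    by (rule has_sum_cong_neutral) (auto simp: mangoldt_sum simp flip: sum_distrib_right)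
  finally show ?thesis
    by (auto dest!: has_sum_imp_sums simp: sums_iff)
qed

section \<open>Zeros of the zeta function\<close>

text \<open>Writing \<open>f w = (w - z) ^ k * g w\<close> with \<open>g\<close> free of zeros near
  \<open>z\<close> gives \<open>(w - z) * f' / f = k + (w - z) * g' / g\<close>. So the order of
  vanishing can be read off as a limit; the point \<open>z'\<close> excludes
  \<open>f = 0\<close>.\<close>

lemma holomorphic_log_deriv_order:
  assumes f: "f holomorphic_on S" and S: "open S" "connected S" and z: "z \<in> S"
    and nz: "z' \<in> S" "f z' \<noteq> 0"
  obtains k :: nat where "((\<lambda>w. (w - z) * deriv f w / f w) \<longlongrightarrow> of_nat k) (at z)"
    "k = 0 \<longleftrightarrow> f z \<noteq> 0" "eventually (\<lambda>w. f w \<noteq> 0) (at z)"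
proof -
  have "\<exists>g r k. 0 < r \<and> ball z r \<subseteq> S \<and> g holomorphic_on ball z r \<and> (k = 0 \<longleftrightarrow> f z \<noteq> 0) \<and>
      (\<forall>w\<in>ball z r. f w = (w - z) ^ k * g w \<and> g w \<noteq> 0)"
  proof (cases "f z = 0")
    case True
    then have "\<not> f constant_on S" using z nz unfolding constant_on_def by metis
    obtain g r n where "0 < n" "0 < r" "ball z r \<subseteq> S" "g holomorphic_on ball z r"
      "\<And>w. w \<in> ball z r \<Longrightarrow> f w = (w - z) ^ n * g w" "\<And>w. w \<in> ball z r \<Longrightarrow> g w \<noteq> 0"
      by (rule holomorphic_factor_zero_nonconstant[OF f S z True \<open>\<not> f constant_on S\<close>]) (rule that)
    with True show ?thesis by (intro exI[of _ g] exI[of _ r] exI[of _ n]) auto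
  next
    case False
    have "continuous (at z) f"
      using S z by (intro continuous_on_interior[OF holomorphic_on_imp_continuous_on[OF f]]) (simp add: interior_open)
    from continuous_at_avoid[OF this False]
    obtain r1 where r1: "r1 > 0" "\<And>w. w \<in> ball z r1 \<Longrightarrow> f w \<noteq> 0" by auto
    obtain r2 where r2: "r2 > 0" "ball z r2 \<subseteq> S" by (rule openE[OF S(1) z])
    have "f holomorphic_on ball z (min r1 r2)"
      by (rule holomorphic_on_subset[OF f]) (use r2 in auto)
    then show ?thesis using False r1 r2
      by (intro exI[of _ f] exI[of _ "min r1 r2"] exI[of _ 0]) auto
  qed
  then obtain g r k where grk: "0 < r \<and> ball z r \<subseteq> S \<and> g holomorphic_on ball z r \<and> (k = 0 \<longleftrightarrow> f z \<noteq> 0) \<and>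
      (\<forall>w\<in>ball z r. f w = (w - z) ^ k * g w \<and> g w \<noteq> 0)"
    by (elim exE) (rule that)
  have r: "0 < r" using grk by (elim conjE)
  have g: "g holomorphic_on ball z r" using grk by (elim conjE)
  have k: "k = 0 \<longleftrightarrow> f z \<noteq> 0" using grk by (elim conjE)
  have fac: "f w = (w - z) ^ k * g w \<and> g w \<noteq> 0" if "w \<in> ball z r" for w
    using grk that by blast
  have ev: "eventually (\<lambda>w. w \<in> ball z r - {z}) (at z)"
    using r by (intro eventually_at_in_open) auto
  have "eventually (\<lambda>w. of_nat k + (w - z) * deriv g w / g w = (w - z) * deriv f w / f w) (at z)"
    using ev
  proof eventually_elim
    case (elim w)
    then have w: "w \<in> ball z r" "w \<noteq> z" by auto
    have "(g has_field_derivative deriv g w) (at w)"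
      by (rule holomorphic_derivI[OF g open_ball w(1)])
    then have "((\<lambda>w. (w - z) ^ k * g w) has_field_derivative
        of_nat k * ((1 - 0) * (w - z) ^ (k - Suc 0)) * g w + deriv g w * (w - z) ^ k) (at w)"
      by (intro DERIV_mult DERIV_power DERIV_diff DERIV_ident DERIV_const)
    then have "((\<lambda>w. (w - z) ^ k * g w) has_field_derivative
        (of_nat k * (w - z) ^ (k - 1) * g w + (w - z) ^ k * deriv g w)) (at w)"
      by (simp add: mult_ac)
    then have "(f has_field_derivative
        (of_nat k * (w - z) ^ (k - 1) * g w + (w - z) ^ k * deriv g w)) (at w)"
      by (rule DERIV_cong_ev[THEN iffD1, OF refl _ refl, rotated])
         (use fac w in \<open>auto intro!: eventually_mono[OF eventually_nhds_in_open[of "ball z r" w]]\<close>)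
    then have "deriv f w = of_nat k * (w - z) ^ (k - 1) * g w + (w - z) ^ k * deriv g w"
      by (rule DERIV_imp_deriv)
    then have "(w - z) * deriv f w =
        (w - z) * (of_nat k * (w - z) ^ (k - 1)) * g w + (w - z) ^ k * ((w - z) * deriv g w)"
      by (simp only: distrib_left mult_ac)
    \<comment> \<open>The truncated exponent \<open>k - 1\<close> does no harm for
      \<open>k = 0\<close>, where both sides are 0.\<close>
    also have "(w - z) * (of_nat k * (w - z) ^ (k - 1)) = of_nat k * (w - z) ^ k"
      by (cases k) (simp_all add: mult_ac)
    finally have "(w - z) * deriv f w = (of_nat k * g w + (w - z) * deriv g w) * (w - z) ^ k"
      by (simp only: distrib_right distrib_left mult_ac)
    moreover have "f w = (w - z) ^ k * g w" "g w \<noteq> 0" "(w - z) ^ k \<noteq> 0"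
      using fac[OF w(1)] w by auto
    ultimately show ?case by (simp add: add_divide_distrib)
  qed
  moreover have "((\<lambda>w. of_nat k + (w - z) * deriv g w / g w) \<longlongrightarrow> of_nat k + (z - z) * deriv g z / g z) (at z)"
  proof (intro tendsto_intros)
    have dg: "deriv g holomorphic_on ball z r" using g by (intro holomorphic_deriv) auto
    have "isCont (deriv g) z" "isCont g z"
      using r by (intro continuous_on_interior[OF holomorphic_on_imp_continuous_on[OF dg]]
          continuous_on_interior[OF holomorphic_on_imp_continuous_on[OF g]]; simp add: interior_open)+
    then show "(deriv g \<longlongrightarrow> deriv g z) (at z)" "(g \<longlongrightarrow> g z) (at z)"
      by (simp_all add: isCont_def)
  qed (use fac[of z] r in auto)
  ultimately have "((\<lambda>w. (w - z) * deriv f w / f w) \<longlongrightarrow> of_nat k + (z - z) * deriv g z / g z) (at z)"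
    by (rule Lim_transform_eventually[rotated])
  then have "((\<lambda>w. (w - z) * deriv f w / f w) \<longlongrightarrow> of_nat k) (at z)"
    by simp
  moreover have "eventually (\<lambda>w. f w \<noteq> 0) (at z)"
    using ev by eventually_elim (use fac in auto)
  ultimately show ?thesis using that k by blast
qed

text \<open>The logarithmic derivative of \<open>(s - 1) * zeta s\<close>, stated without division
  because zeros have not been excluded yet.\<close>

lemma Mangoldt_series_mult_Zeta_reg:
  assumes s: "Re s > 1"
  shows "Mangoldt_series s * ((s - 1) * Zeta_reg s) = Zeta_reg s - (s - 1) * deriv Zeta_reg s"
proof -
  have "(zeta has_field_derivative - (Mangoldt_series s * zeta s)) (at s)"
    using zeta_has_derivative[OF s] by (simp add: Mangoldt_series_mult_zeta[OF s])
  then have "((\<lambda>s. (s - 1) * zeta s) has_field_derivative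
      (1 - 0) * zeta s + - (Mangoldt_series s * zeta s) * (s - 1)) (at s)"
    by (intro DERIV_mult DERIV_diff DERIV_ident DERIV_const)
  then have "((\<lambda>s. (s - 1) * zeta s) has_field_derivative zeta s - (s - 1) * (Mangoldt_series s * zeta s)) (at s)"
    by (simp add: mult_ac)
  then have "(Zeta_reg has_field_derivative zeta s - (s - 1) * (Mangoldt_series s * zeta s)) (at s)"
    by (rule DERIV_cong_ev[THEN iffD1, OF refl _ refl, rotated])
       (use s in \<open>auto intro!: eventually_mono[OF eventually_nhds_in_open[of "{s. Re s > 1}" s]]
          simp: Zeta_reg_eq open_halfspace_Re_gt\<close>)
  then have deriv_eq: "deriv Zeta_reg s = zeta s - (s - 1) * (Mangoldt_series s * zeta s)"
    by (rule DERIV_imp_deriv)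
  show ?thesis unfolding deriv_eq Zeta_reg_eq[OF s] by (simp add: algebra_simps)
qed

lemma Mangoldt_series_eq:
  assumes s: "Re s > 1" and Z: "Zeta_reg s \<noteq> 0"
  shows "Mangoldt_series s = 1 / (s - 1) - deriv Zeta_reg s / Zeta_reg s"
proof -
  have solve: "m = 1 / u - d / z" if "m * (u * z) = z - u * d" "u \<noteq> 0" "z \<noteq> 0" for m u d z :: complex
    using that by (simp add: field_simps)
  have "s - 1 \<noteq> 0" using s by auto
  from solve[OF Mangoldt_series_mult_Zeta_reg[OF s] this Z] show ?thesis .
qed

lemma filterlim_add_of_real_at_right:
  "filterlim (\<lambda>e. s + complex_of_real e) (at s) (at_right 0)"
proof -
  have "((\<lambda>e. s + complex_of_real e) \<longlongrightarrow> s + of_real 0) (at_right 0)"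
    by (intro tendsto_intros)
  moreover have "eventually (\<lambda>e. s + complex_of_real e \<noteq> s) (at_right 0)"
    using eventually_at_right_less[of 0] by eventually_elim simp
  ultimately show ?thesis by (simp add: filterlim_at)
qed

text \<open>In \<open>1 / (s - 1) - Z' / Z\<close>, with \<open>Z = Zeta_reg\<close>, the first term
  has residue 1 at \<open>s = 1\<close> and the second contributes minus the order of the zero.
  Approaching \<open>s\<close> horizontally from the right stays where the Dirichlet series
  converges, also when \<open>Re s = 1\<close>.\<close>

lemma Mangoldt_series_residue:
  assumes s: "Re s \<ge> 1"
  obtains k :: nat where
    "((\<lambda>e. of_real e * Mangoldt_series (s + of_real e)) \<longlongrightarrow> (if s = 1 then 1 else 0) - of_nat k) (at_right 0)"
    "k = 0 \<longleftrightarrow> Zeta_reg s \<noteq> 0"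
proof -
  obtain k :: nat where lim: "((\<lambda>w. (w - s) * deriv Zeta_reg w / Zeta_reg w) \<longlongrightarrow> of_nat k) (at s)"
    and k: "k = 0 \<longleftrightarrow> Zeta_reg s \<noteq> 0" and ev: "eventually (\<lambda>w. Zeta_reg w \<noteq> 0) (at s)"
    by (rule holomorphic_log_deriv_order[OF holomorphic_Zeta_reg, of s 1])
       (use s in \<open>auto simp: open_halfspace_Re_gt convex_connected convex_halfspace_Re_gt\<close>)
  note flt = filterlim_add_of_real_at_right[of s]
  have "((\<lambda>e. of_real e / (s + of_real e - 1)) \<longlongrightarrow> (if s = 1 then 1 else 0)) (at_right 0)"
  proof (cases "s = 1")
    case True
    have "eventually (\<lambda>e. of_real e / (s + of_real e - 1) = 1) (at_right 0)"
      using True by (auto intro!: eventually_mono[OF eventually_at_right_less[of 0]])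
    with True show ?thesis by (simp add: tendsto_eventually)
  qed (auto intro!: tendsto_eq_intros)
  then have "((\<lambda>e. of_real e / (s + of_real e - 1)
      - (s + of_real e - s) * deriv Zeta_reg (s + of_real e) / Zeta_reg (s + of_real e)) \<longlongrightarrow>
      (if s = 1 then 1 else 0) - of_nat k) (at_right 0)"
    using filterlim_compose[OF lim flt] by (intro tendsto_diff)
  moreover have "eventually (\<lambda>e. of_real e / (s + of_real e - 1)
      - (s + of_real e - s) * deriv Zeta_reg (s + of_real e) / Zeta_reg (s + of_real e)
      = of_real e * Mangoldt_series (s + of_real e)) (at_right 0)"
    using eventually_compose_filterlim[OF ev flt] eventually_at_right_less[of 0]
  proof eventually_elim
    case (elim e)
    let ?w = "s + of_real e"
    have w: "Re ?w > 1" using s elim by simp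
    have "Mangoldt_series ?w = 1 / (?w - 1) - deriv Zeta_reg ?w / Zeta_reg ?w"
      by (rule Mangoldt_series_eq[OF w elim(1)])
    then show ?case by (simp add: right_diff_distrib)
  qed
  ultimately have "((\<lambda>e. of_real e * Mangoldt_series (s + of_real e)) \<longlongrightarrow> (if s = 1 then 1 else 0) - of_nat k) (at_right 0)"
    by (rule Lim_transform_eventually)
  then show ?thesis using that k by blast
qed

section \<open>The 3-4-1 inequality and non-vanishing on the closed half-plane\<close>

lemma cos_341_nonneg: "3 + 4 * cos x + cos (2 * x) \<ge> (0::real)"
proof -
  have "3 + 4 * cos x + cos (2 * x) = 2 * (1 + cos x)\<^sup>2"
    unfolding cos_double_cos by (simp add: power2_eq_square algebra_simps)
  then show ?thesis by simp
qed

lemma Re_nat_powr: "Re (of_nat n powr (- Complex a b)) = real n powr (-a) * cos (b * ln n)"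
  by (cases "n = 0") (auto simp: powr_def Re_exp Ln_of_nat algebra_simps)

text \<open>The cosine inequality holds term by term with angle \<open>t * ln n\<close>, and the
  weights \<open>mangoldt n * n powr (-a)\<close> are nonnegative.\<close>

lemma Mangoldt_series_341:
  assumes "a > 1"
  shows "3 * Re (Mangoldt_series (of_real a)) + 4 * Re (Mangoldt_series (Complex a t))
           + Re (Mangoldt_series (Complex a (2 * t))) \<ge> 0"
proof -
  have sums: "(\<lambda>n. mangoldt n * (real n powr (-a) * cos (b * ln n))) sums Re (Mangoldt_series (Complex a b))" for b
  proof -
    have "(\<lambda>n. mangoldt n * of_nat n powr (- Complex a b)) sums Mangoldt_series (Complex a b)"
      using assms unfolding Mangoldt_series_def
      by (intro summable_sums summable_norm_cancel[OF summable_mangoldt]) auto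
    from sums_Re[OF this] show ?thesis by (simp add: Re_nat_powr)
  qed
  have "(\<lambda>n. 3 * (mangoldt n * (real n powr (-a) * cos (0 * ln n)))
      + 4 * (mangoldt n * (real n powr (-a) * cos (t * ln n)))
      + mangoldt n * (real n powr (-a) * cos (2 * t * ln n))) sums
      (3 * Re (Mangoldt_series (Complex a 0)) + 4 * Re (Mangoldt_series (Complex a t))
           + Re (Mangoldt_series (Complex a (2 * t))))" (is "?f sums ?S")
    by (rule sums_add[OF sums_add[OF sums_mult[OF sums[of 0]] sums_mult[OF sums[of t]]] sums[of "2 * t"]])
  moreover have "?f n \<ge> 0" for n
  proof -
    have "?f n = mangoldt n * real n powr (-a) * (3 + 4 * cos (t * ln n) + cos (2 * (t * ln n)))"
      by (simp add: algebra_simps)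
    also have "\<dots> \<ge> 0"
      using cos_341_nonneg by (intro mult_nonneg_nonneg mangoldt_nonneg) auto
    finally show ?thesis .
  qed
  ultimately have "?S \<ge> 0" by (rule sums_le[OF _ sums_zero, rotated])
  then show ?thesis by (simp add: complex_of_real_def)
qed

theorem Zeta_reg_nonzero:
  assumes s: "Re s \<ge> 1"
  shows "Zeta_reg s \<noteq> 0"
proof (cases "s = 1")
  case False
  obtain k :: nat where
    lim': "((\<lambda>e. of_real e * Mangoldt_series (s + of_real e)) \<longlongrightarrow> (if s = 1 then 1 else 0) - of_nat k) (at_right 0)"
    and k: "k = 0 \<longleftrightarrow> Zeta_reg s \<noteq> 0"
    by (rule Mangoldt_series_residue[OF s])
  have lim: "((\<lambda>e. of_real e * Mangoldt_series (s + of_real e)) \<longlongrightarrow> - of_nat k) (at_right 0)"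
    using lim' False by simp
  have "k = 0"
  proof (cases "Re s = 1")
    case True
    define t where "t = Im s"
    have st: "s = Complex 1 t" by (simp add: t_def True complex_eq_iff)
    with False have t: "t \<noteq> 0" by (auto simp: complex_eq_iff)
    obtain l :: nat where
      lim2': "((\<lambda>e. of_real e * Mangoldt_series (Complex 1 (2 * t) + of_real e)) \<longlongrightarrow>
          (if Complex 1 (2 * t) = 1 then 1 else 0) - of_nat l) (at_right 0)"
      by (rule Mangoldt_series_residue[of "Complex 1 (2 * t)"]) simp
    \<comment> \<open>Away from the pole the limit at \<open>1 + 2it\<close> is
      \<open>- l \<le> 0\<close>, so this point cannot offset a zero at \<open>s\<close>.\<close>
    have "Complex 1 (2 * t) \<noteq> 1" using t by (simp add: complex_eq_iff)
    with lim2' have lim2: "((\<lambda>e. of_real e * Mangoldt_series (Complex 1 (2 * t) + of_real e)) \<longlongrightarrow>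
          - of_nat l) (at_right 0)"
      by simp
    obtain m :: nat where
      "((\<lambda>e. of_real e * Mangoldt_series (1 + of_real e)) \<longlongrightarrow> (if (1::complex) = 1 then 1 else 0) - of_nat m) (at_right 0)"
      "m = 0 \<longleftrightarrow> Zeta_reg 1 \<noteq> 0"
      by (rule Mangoldt_series_residue[of 1]) simp
    then have lim1: "((\<lambda>e. of_real e * Mangoldt_series (1 + of_real e)) \<longlongrightarrow> 1) (at_right 0)"
      by simp
    have "((\<lambda>e. 3 * Re (of_real e * Mangoldt_series (1 + of_real e))
         + 4 * Re (of_real e * Mangoldt_series (s + of_real e))
         + Re (of_real e * Mangoldt_series (Complex 1 (2 * t) + of_real e))) \<longlongrightarrow>
         3 * Re 1 + 4 * Re (- of_nat k) + Re (- of_nat l)) (at_right 0)"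
      by (intro tendsto_intros lim lim1 lim2)
    moreover have "eventually (\<lambda>e. 3 * Re (of_real e * Mangoldt_series (1 + of_real e))
         + 4 * Re (of_real e * Mangoldt_series (s + of_real e))
         + Re (of_real e * Mangoldt_series (Complex 1 (2 * t) + of_real e)) \<ge> 0) (at_right 0)"
      using eventually_at_right_less[of 0]
    proof eventually_elim
      case (elim e)
      have "0 \<le> e * (3 * Re (Mangoldt_series (of_real (1 + e))) + 4 * Re (Mangoldt_series (Complex (1 + e) t))
           + Re (Mangoldt_series (Complex (1 + e) (2 * t))))"
        using Mangoldt_series_341[of "1 + e" t] elim by simp
      moreover have "Complex (1 + e) b = Complex 1 b + of_real e" for b
        by (simp add: complex_eq_iff)
      ultimately show ?case by (simp add: st algebra_simps)
    qed
    \<comment> \<open>That is \<open>3 - 4k - l \<ge> 0\<close> in natural numbers. The coefficient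
      4 exceeding 3 is what forces \<open>k = 0\<close>.\<close>
    ultimately have "3 * Re 1 + 4 * Re (- of_nat k) + Re (- of_nat l) \<ge> 0"
      by (intro tendsto_lowerbound) auto
    then show "k = 0" by (cases k) auto
  next
    case False
    then have s1: "Re s > 1" using s by simp
    \<comment> \<open>To the right of the line the series stays bounded by its absolute sum at
      \<open>s\<close>, so the limit that equals \<open>- k\<close> is 0.\<close>
    let ?M = "\<Sum>n. norm (mangoldt n * of_nat n powr (-s) :: complex)"
    have "eventually (\<lambda>e. norm (of_real e * Mangoldt_series (s + of_real e)) \<le> e * ?M) (at_right 0)"
      using eventually_at_right_less[of 0]
    proof eventually_elim
      case (elim e)
      have "norm (Mangoldt_series (s + of_real e)) \<le> (\<Sum>n. norm (mangoldt n * of_nat n powr (-(s + of_real e)) :: complex))"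
        unfolding Mangoldt_series_def using s1 elim
        by (intro summable_norm summable_mangoldt) auto
      also have "\<dots> \<le> ?M"
      proof (intro suminf_le summable_mangoldt)
        show "norm (mangoldt n * of_nat n powr (-(s + of_real e)) :: complex) \<le> norm (mangoldt n * of_nat n powr (-s) :: complex)" for n
          using elim mangoldt_nonneg[of n] by (cases "n = 0")
            (auto simp: norm_mult norm_nat_powr intro!: mult_left_mono powr_mono)
      qed (use s1 elim in auto)
      finally show ?case using elim by (simp add: norm_mult mult_left_mono)
    qed
    moreover have "((\<lambda>e. e * ?M) \<longlongrightarrow> 0) (at_right 0)"
      by (auto intro!: tendsto_eq_intros)
    ultimately have "((\<lambda>e. of_real e * Mangoldt_series (s + of_real e)) \<longlongrightarrow> 0) (at_right 0)"
      by (rule Lim_null_comparison)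
    from tendsto_unique[OF _ lim this] show "k = 0" by simp
  qed
  with k show ?thesis by simp
qed auto

section \<open>Chebyshev's bound and a monotone Tauberian argument\<close>

definition psi :: "nat \<Rightarrow> real" where
  "psi n = (\<Sum>k=1..n. mangoldt k)"

lemma psi_0 [simp]: "psi 0 = 0"
  by (simp add: psi_def)

lemma psi_Suc [simp]: "psi (Suc n) = psi n + mangoldt (Suc n)"
  by (simp add: psi_def)

lemma mono_psi: "m \<le> n \<Longrightarrow> psi m \<le> psi n"
  unfolding psi_def by (intro sum_mono2 mangoldt_nonneg) auto

lemma psi_nonneg: "psi n \<ge> 0"
  unfolding psi_def by (intro sum_nonneg mangoldt_nonneg)

text \<open>Passing from \<open>n\<close> to \<open>n + 1\<close> raises \<open>n div d\<close> by 1
  exactly for the divisors \<open>d\<close> of \<open>n + 1\<close>, whose Lambda values add up to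
  \<open>ln (n + 1)\<close>. The free upper limit \<open>N\<close> puts the formulas for
  \<open>n\<close> and \<open>2 * n\<close> over the same range, so that they can be
  subtracted.\<close>

lemma ln_fact_mangoldt:
  assumes "n \<le> N"
  shows "ln (fact n) = (\<Sum>d=1..N. mangoldt d * real (n div d))"
  using assms
proof (induction n)
  case (Suc n)
  have div: "real (Suc n div d) = real (n div d) + (if d dvd Suc n then 1 else 0)" for d
    by (simp add: div_Suc dvd_eq_mod_eq_0)
  have "{d. d dvd Suc n} \<subseteq> {1..N}"
  proof
    fix d assume "d \<in> {d. d dvd Suc n}"
    then have "d \<le> Suc n" "d > 0" by (auto intro: dvd_imp_le dvd_pos_nat)
    then show "d \<in> {1..N}" using Suc.prems by simp
  qed
  then have "(\<Sum>d=1..N. mangoldt d * (if d dvd Suc n then 1 else 0)) = (\<Sum>d | d dvd Suc n. mangoldt d :: real)"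
    by (intro sum.mono_neutral_cong_right) auto
  also have "\<dots> = ln (real (Suc n))"
    using mangoldt_sum[of "Suc n", where ?'a = real] by simp
  finally have "(\<Sum>d=1..N. mangoldt d * real (Suc n div d)) = ln (fact n) + ln (real (Suc n))"
    using Suc unfolding div by (simp add: distrib_left sum.distrib)
  also have "\<dots> = ln (fact (Suc n))"
    by (simp add: ln_mult mult_ac del: of_nat_Suc)
  finally show ?case by simp
qed auto

text \<open>The logarithm of the central binomial coefficient weights \<open>mangoldt d\<close> by
  \<open>2n div d - 2 (n div d)\<close>. This weight is never negative and is at least 1 for
  \<open>n < d \<le> 2n\<close>, while the coefficient is at most \<open>4 ^ n\<close>.\<close>

lemma psi_double_le: "psi (2 * n) \<le> psi n + 2 * real n"
proof -
  have choose: "ln (real (2 * n choose n)) = ln (fact (2 * n)) - 2 * ln (fact n)"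
  proof -
    have "real (2 * n choose n) = fact (2 * n) / (fact n * fact n)"
      using binomial_fact[of n "2 * n", where ?'a = real] by (simp add: mult_2)
    then show ?thesis by (simp add: ln_div ln_mult)
  qed
  have "psi (2 * n) - psi n = (\<Sum>d=n+1..2*n. mangoldt d)"
    unfolding psi_def using sum.ub_add_nat[of 1 n "mangoldt :: nat \<Rightarrow> real" n] by (simp add: mult_2)
  also have "\<dots> \<le> (\<Sum>d=n+1..2*n. mangoldt d * (real (2 * n div d) - 2 * real (n div d)))"
  proof (rule sum_mono)
    fix d assume d: "d \<in> {n+1..2*n}"
    then have "n div d = 0" "2 * n div d \<ge> 1"
      by (auto simp: div_greater_zero_iff Suc_le_eq)
    then show "mangoldt d \<le> mangoldt d * (real (2 * n div d) - 2 * real (n div d))"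
      using mult_left_mono[of 1 "real (2 * n div d)" "mangoldt d"] mangoldt_nonneg[of d] by simp
  qed
  also have "\<dots> \<le> (\<Sum>d=1..2*n. mangoldt d * (real (2 * n div d) - 2 * real (n div d)))"
  proof (intro sum_mono2 mult_nonneg_nonneg mangoldt_nonneg)
    fix d
    have "2 * (n div d) \<le> 2 * n div d"
      by (metis div_mult1_eq le_add1 mult.commute)
    then show "real (2 * n div d) - 2 * real (n div d) \<ge> 0" by linarith
  qed auto
  also have "\<dots> = ln (fact (2 * n)) - 2 * ln (fact n)"
    using ln_fact_mangoldt[of "2 * n" "2 * n"] ln_fact_mangoldt[of n "2 * n"]
    by (simp add: right_diff_distrib sum_subtractf sum_distrib_left mult_ac)
  also have "\<dots> = ln (real (2 * n choose n))" by (rule choose[symmetric])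
  also have "\<dots> \<le> ln (2 ^ (2 * n))"
  proof (subst ln_le_cancel_iff)
    have "2 * n choose n \<le> (\<Sum>k\<le>2 * n. 2 * n choose k)"
      by (rule member_le_sum) auto
    also have "\<dots> = 2 ^ (2 * n)" by (rule choose_row_sum)
    finally show "real (2 * n choose n) \<le> 2 ^ (2 * n)"
      by (metis of_nat_le_iff of_nat_numeral of_nat_power)
  qed (auto simp: zero_less_binomial)
  also have "\<dots> \<le> 2 * real n"
    using ln_2_less_1 by (simp add: ln_realpow mult_left_le)
  finally show ?thesis by simp
qed

text \<open>Halving the argument costs \<open>2m\<close> and induction supplies \<open>4m\<close>,
  so \<open>psi (2m) \<le> 6m\<close>. The constant 4 leaves another \<open>2m\<close> of room,
  which absorbs the single logarithm of the odd case.\<close>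

theorem psi_le: "psi n \<le> 4 * real n"
proof (induction n rule: less_induct)
  case (less n)
  consider "n = 0" | m where "n = 2 * m" "m > 0" | m where "n = 2 * m + 1"
    by (metis gr0I mult_0_right oddE evenE)
  then show ?case
  proof cases
    case 2
    then show ?thesis using less[of m] psi_double_le[of m] by simp
  next
    case 3
    have "psi n \<le> psi (2 * m) + ln (real n)"
      using 3 mangoldt_le[of n] by simp
    also have "ln (real n) \<le> 2 * real m"
      using 3 ln_le_minus_one[of "real n"] by simp
    finally show ?thesis using 3 less[of m] psi_double_le[of m] by simp
  qed auto
qed

text \<open>If \<open>f N\<close> deviates from \<open>N\<close> by \<open>\<epsilon> N\<close>, then by monotonicity \<open>f k\<close> deviates from \<open>k\<close> by
  \<open>\<epsilon> N / 2\<close> on about \<open>\<epsilon> N / 2\<close> consecutive integers next to \<open>N\<close>, and that block of the series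
  has size at least \<open>\<epsilon>\<^sup>2 / 32\<close>, contradicting the Cauchy criterion.\<close>

lemma mono_Cesaro_tendsto:
  fixes f :: "nat \<Rightarrow> real"
  assumes mono: "\<And>m n. m \<le> n \<Longrightarrow> f m \<le> f n"
    and summable: "summable (\<lambda>n. (f n - real n) / real n ^ 2)"
  shows "(\<lambda>n. f n / real n) \<longlonglongrightarrow> 1"
proof (rule tendstoI)
  fix e :: real assume "e > 0"
  \<comment> \<open>The cap at 1 gives \<open>2 * K \<le> N\<close> below, so the block to the left
    of \<open>N\<close> starts at \<open>N / 2\<close> or later and hence beyond
    \<open>M\<close>.\<close>
  define \<epsilon> where "\<epsilon> = min (e / 2) 1"
  have \<epsilon>: "\<epsilon> > 0" "\<epsilon> \<le> 1" "\<epsilon> < e" using \<open>e > 0\<close> by (auto simp: \<epsilon>_def)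
  have "\<epsilon>\<^sup>2 / 32 > 0" using \<epsilon> by simp
  then obtain M where M: "\<And>m n. m \<ge> M \<Longrightarrow> norm (\<Sum>k=m..<n. (f k - real k) / real k ^ 2) < \<epsilon>\<^sup>2 / 32"
    using summable unfolding summable_Cauchy by blast
  have "eventually (\<lambda>N. real N \<ge> 2 / \<epsilon> \<and> N \<ge> 2 * M + 1) sequentially"
    by (intro eventually_conj eventually_ge_at_top)
       (metis (mono_tags) eventually_at_top_linorder filterlim_at_top filterlim_real_sequentially)
  then show "eventually (\<lambda>N. dist (f N / real N) 1 < e) sequentially"
  proof eventually_elim
    case (elim N)
    define K where "K = nat \<lfloor>\<epsilon> * real N / 2\<rfloor>"
    have N: "N > 0" "real N > 0" using elim by auto
    have "\<epsilon> * real N / 2 \<ge> 1" using elim \<epsilon> by (simp add: field_simps)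
    then have "\<lfloor>\<epsilon> * real N / 2\<rfloor> \<ge> 1" by (simp only: one_le_floor)
    then have K: "real K \<le> \<epsilon> * real N / 2" "real K \<ge> \<epsilon> * real N / 4"
      unfolding K_def by linarith+
    have "\<epsilon> * real N \<le> 1 * real N" using \<epsilon> N by (intro mult_right_mono) auto
    then have KN: "2 * real K \<le> real N" using K by linarith
    then have KN': "2 * K \<le> N" by linarith
    have sq: "real k ^ 2 \<le> 4 * real N ^ 2" if "k \<le> 2 * N" for k
    proof -
      have "real k ^ 2 \<le> (2 * real N) ^ 2" using that by (intro power_mono) auto
      then show ?thesis by (simp add: power_mult_distrib)
    qed
    have block: "\<epsilon>\<^sup>2 / 32 \<le> real K * (\<epsilon> / (8 * real N))"
    proof -
      have "\<epsilon>\<^sup>2 / 32 = (\<epsilon> * real N / 4) * (\<epsilon> / (8 * real N))"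
        using N by (simp add: power2_eq_square)
      also have "\<dots> \<le> real K * (\<epsilon> / (8 * real N))"
        using K \<epsilon> N by (intro mult_right_mono) auto
      finally show ?thesis .
    qed
    \<comment> \<open>The excess \<open>\<epsilon> N / 2\<close> is divided by at most
      \<open>(2N)\<^sup>2\<close>. With \<open>K \<ge> \<epsilon> N / 4\<close> terms this gives
      \<open>\<epsilon>\<^sup>2 / 32\<close>.\<close>
    have term_ge: "\<epsilon> / (8 * real N) \<le> x / real k ^ 2" if "x \<ge> \<epsilon> * real N / 2" "k > 0" "k \<le> 2 * N" for x k
    proof -
      have "x \<ge> 0" using that(1) \<epsilon> N by (smt (verit) divide_nonneg_pos mult_pos_pos)
      have "\<epsilon> / (8 * real N) = (\<epsilon> * real N / 2) / (4 * real N ^ 2)"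
        using N by (simp add: power2_eq_square)
      also have "\<dots> \<le> x / real k ^ 2"
        using that sq[of k] \<open>x \<ge> 0\<close> by (intro frac_le) auto
      finally show ?thesis .
    qed
    have "f N \<le> (1 + \<epsilon>) * real N"
    proof (rule ccontr)
      assume "\<not> ?thesis"
      then have fN: "f N > (1 + \<epsilon>) * real N" by simp
      have "real (card {N..<N+K}) * (\<epsilon> / (8 * real N)) \<le> (\<Sum>k=N..<N+K. (f k - real k) / real k ^ 2)"
      proof (rule sum_bounded_below)
        fix k assume k: "k \<in> {N..<N+K}"
        have "real k \<le> real N + real K" using k by auto
        moreover have "f k \<ge> f N" using k by (intro mono) auto
        ultimately have "f k - real k \<ge> \<epsilon> * real N / 2"
          using fN K by (simp add: algebra_simps)
        then show "\<epsilon> / (8 * real N) \<le> (f k - real k) / real k ^ 2"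
          using k N KN' by (intro term_ge) auto
      qed
      also have "\<dots> < \<epsilon>\<^sup>2 / 32"
        using M[of N "N + K"] elim by auto
      finally show False using block by simp
    qed
    moreover have "f N \<ge> (1 - \<epsilon>) * real N"
    proof (rule ccontr)
      assume "\<not> ?thesis"
      then have fN: "f N < (1 - \<epsilon>) * real N" by simp
      have "real (card {N-K..<N}) * (\<epsilon> / (8 * real N)) \<le> (\<Sum>k=N-K..<N. - ((f k - real k) / real k ^ 2))"
      proof (rule sum_bounded_below)
        fix k assume k: "k \<in> {N-K..<N}"
        then have "real k \<ge> real N - real K" by auto
        moreover have "f k \<le> f N" using k by (intro mono) auto
        ultimately have "- (f k - real k) \<ge> \<epsilon> * real N / 2"
          using fN K by (simp add: algebra_simps)
        then have "\<epsilon> / (8 * real N) \<le> - (f k - real k) / real k ^ 2"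
          using k N KN' by (intro term_ge) auto
        then show "\<epsilon> / (8 * real N) \<le> - ((f k - real k) / real k ^ 2)"
          by (simp only: minus_divide_left)
      qed
      also have "\<dots> = - (\<Sum>k=N-K..<N. (f k - real k) / real k ^ 2)"
        by (rule sum_negf)
      also have "\<dots> \<le> norm (\<Sum>k=N-K..<N. (f k - real k) / real k ^ 2)"
        by simp
      also have "\<dots> < \<epsilon>\<^sup>2 / 32"
        using KN' elim by (intro M) linarith
      finally show False using block KN' by simp
    qed
    ultimately have "\<bar>f N / real N - 1\<bar> \<le> \<epsilon>"
      using N by (auto simp: abs_le_iff field_simps)
    then show ?case using \<epsilon> by (simp add: dist_real_def)
  qed
qed

section \<open>Newman's Tauberian theorem\<close>

lemma powr_Suc_diff_MVT:
  assumes "n > 0"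
  obtains \<xi> where "real n < \<xi>" "\<xi> < real (Suc n)"
    "real (Suc n) powr p - real n powr p = p * \<xi> powr (p - 1)"
proof -
  have "\<exists>\<xi>>real n. \<xi> < real (Suc n) \<and>
      real (Suc n) powr p - real n powr p = (real (Suc n) - real n) * (p * \<xi> powr (p - 1))"
    using assms by (intro MVT2) (auto intro!: derivative_eq_intros)
  then show ?thesis using that by auto
qed

lemma powr_Suc_le_diff:
  assumes x: "x > 0" and n: "n > 0"
  shows "real (Suc n) powr (-x - 1) \<le> (real n powr (-x) - real (Suc n) powr (-x)) / x"
proof -
  obtain \<xi> where \<xi>: "real n < \<xi>" "\<xi> < real (Suc n)"
      "real (Suc n) powr (-x) - real n powr (-x) = -x * \<xi> powr (-x - 1)"
    by (rule powr_Suc_diff_MVT[OF n])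
  have "real (Suc n) powr (-x - 1) \<le> \<xi> powr (-x - 1)"
    using \<xi> n x by (intro powr_mono2') auto
  also have "\<dots> = (real n powr (-x) - real (Suc n) powr (-x)) / x"
    using \<xi>(3) x by (simp add: field_simps del: of_nat_Suc)
  finally show ?thesis .
qed

lemma sum_powr_tail_le:
  assumes x: "x > 0" and N: "N > 0" "N \<le> M"
  shows "(\<Sum>n=Suc N..M. real n powr (-x - 1)) \<le> (real N powr (-x) - real M powr (-x)) / x"
  using N(2)
proof (induction M rule: dec_induct)
  case (step M)
  then show ?case
    using powr_Suc_le_diff[OF x, of M] N by (simp add: diff_divide_distrib)
qed auto

text \<open>The monotonicity of \<open>x powr (y - 1)\<close> changes at \<open>y = 1\<close>. In
  the increasing case the integral controls only the terms below \<open>N\<close>, and the last term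
  has to be added separately.\<close>

lemma sum_powr_le:
  assumes y: "y > 0"
  shows "(\<Sum>n\<le>N. real n powr (y - 1)) \<le> real N powr y / y + real N powr (y - 1)"
proof (cases "y \<ge> 1")
  case True
  have "(\<Sum>n<N. real n powr (y - 1)) \<le> real N powr y / y"
  proof (induction N)
    case (Suc N)
    have "real N powr (y - 1) \<le> (real (Suc N) powr y - real N powr y) / y"
    proof (cases "N = 0")
      case False
      obtain \<xi> where \<xi>: "real N < \<xi>" "\<xi> < real (Suc N)"
        "real (Suc N) powr y - real N powr y = y * \<xi> powr (y - 1)"
        by (rule powr_Suc_diff_MVT[of N]) (use False in auto)
      have "real N powr (y - 1) \<le> \<xi> powr (y - 1)"
        using \<xi> True by (intro powr_mono2) auto
      also have "\<dots> = (real (Suc N) powr y - real N powr y) / y"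
        using \<xi>(3) y by (simp add: field_simps del: of_nat_Suc)
      finally show ?thesis .
    qed (use y in auto)
    then show ?case using Suc by (simp add: diff_divide_distrib)
  qed auto
  then show ?thesis by (simp add: lessThan_Suc_atMost[symmetric])
next
  case False
  have "(\<Sum>n\<le>N. real n powr (y - 1)) \<le> real N powr y / y"
  proof (induction N)
    case (Suc N)
    have "real (Suc N) powr (y - 1) \<le> (real (Suc N) powr y - real N powr y) / y"
    proof (cases "N = 0")
      case True
      then show ?thesis using False y by simp
    next
      case nz: False
      obtain \<xi> where \<xi>: "real N < \<xi>" "\<xi> < real (Suc N)"
        "real (Suc N) powr y - real N powr y = y * \<xi> powr (y - 1)"
        by (rule powr_Suc_diff_MVT[of N]) (use nz in auto)
      have "real (Suc N) powr (y - 1) \<le> \<xi> powr (y - 1)"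
        using \<xi> False nz by (intro powr_mono2') auto
      also have "\<dots> = (real (Suc N) powr y - real N powr y) / y"
        using \<xi>(3) y by (simp add: field_simps del: of_nat_Suc)
      finally show ?thesis .
    qed
    then show ?case using Suc by (simp add: diff_divide_distrib)
  qed auto
  then show ?thesis by (meson add_increasing2 powr_ge_zero)
qed

text \<open>The left half may be any path, so the winding number is computed from primitives of
  \<open>1 / z\<close>: \<open>Ln z\<close> on the right and \<open>Ln (- z)\<close> on the left,
  each with its branch cut in the other half-plane. Both contribute
  \<open>\<i> * pi\<close>.\<close>

lemma Cauchy_integral_two_halves:
  assumes U: "convex U" "open U" "0 \<in> U" and f: "f holomorphic_on U"
    and g1: "valid_path g1" "path_image g1 \<subseteq> U \<inter> {z. Re z \<ge> 0} - {0}"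
    and g2: "valid_path g2" "path_image g2 \<subseteq> U \<inter> {z. Re z \<le> 0} - {0}"
    and ends: "pathstart g1 = - \<i> * of_real R" "pathfinish g1 = \<i> * of_real R"
      "pathstart g2 = \<i> * of_real R" "pathfinish g2 = - \<i> * of_real R" and R: "R > 0"
  shows "contour_integral g1 (\<lambda>z. f z / z) + contour_integral g2 (\<lambda>z. f z / z) = 2 * pi * \<i> * f 0"
    and "(\<lambda>z. f z / z) contour_integrable_on g1" and "(\<lambda>z. f z / z) contour_integrable_on g2"
proof -
  have hol: "(\<lambda>z. f z / z) holomorphic_on U - {0}"
    by (intro holomorphic_on_divide holomorphic_on_subset[OF f] holomorphic_on_ident) auto
  have op: "open (U - {0})" using U by (intro open_delete)
  show int1: "(\<lambda>z. f z / z) contour_integrable_on g1"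
    using g1 by (intro contour_integrable_holomorphic_simple[OF hol op]) auto
  show int2: "(\<lambda>z. f z / z) contour_integrable_on g2"
    using g2 by (intro contour_integrable_holomorphic_simple[OF hol op]) auto
  have p1: "((\<lambda>z. 1 / z) has_contour_integral (Ln (pathfinish g1) - Ln (pathstart g1))) g1"
  proof (rule contour_integral_primitive[OF _ g1])
    fix z :: complex assume "z \<in> U \<inter> {z. Re z \<ge> 0} - {0}"
    then have "z \<notin> \<real>\<^sub>\<le>\<^sub>0" by (auto simp: complex_nonpos_Reals_iff complex_eq_iff)
    then show "(Ln has_field_derivative 1 / z) (at z within U \<inter> {z. Re z \<ge> 0} - {0})"
      by (metis has_field_derivative_Ln has_field_derivative_at_within inverse_eq_divide)
  qed
  have p2: "((\<lambda>z. 1 / z) has_contour_integral (Ln (- pathfinish g2) - Ln (- pathstart g2))) g2"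
  proof (rule contour_integral_primitive[OF _ g2])
    fix z :: complex assume "z \<in> U \<inter> {z. Re z \<le> 0} - {0}"
    then have z: "- z \<notin> \<real>\<^sub>\<le>\<^sub>0" "z \<noteq> 0" by (auto simp: complex_nonpos_Reals_iff complex_eq_iff)
    have "((\<lambda>z. Ln (- z)) has_field_derivative inverse (- z) * (- 1)) (at z)"
      using z(1) by (intro DERIV_chain2[where f = Ln and g = uminus] has_field_derivative_Ln DERIV_minus DERIV_ident)
    then show "((\<lambda>z. Ln (- z)) has_field_derivative 1 / z) (at z within U \<inter> {z. Re z \<le> 0} - {0})"
      by (simp add: has_field_derivative_at_within inverse_eq_divide)
  qed
  have join: "pathfinish g1 = pathstart g2" using ends by simp
  have Ln: "Ln (\<i> * of_real R) = of_real (ln R) + \<i> * (pi / 2)" "Ln (- (\<i> * of_real R)) = of_real (ln R) - \<i> * (pi / 2)"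
    using Ln_times_of_real[OF R, of \<i>] Ln_times_of_real[OF R, of "- \<i>"]
    by (simp_all add: mult.commute Ln_of_real[OF R])
  have zero: "0 \<notin> path_image (g1 +++ g2)"
    using g1(2) g2(2) unfolding path_image_join[OF join] by blast
  have vp: "valid_path (g1 +++ g2)" using g1 g2 join by simp
  have "((\<lambda>z. 1 / z) has_contour_integral (2 * pi * \<i>)) (g1 +++ g2)"
    using has_contour_integral_join[OF p1 p2 g1(1) g2(1)] by (simp add: ends Ln algebra_simps)
  then have wn: "winding_number (g1 +++ g2) 0 = 1"
    using winding_number_valid_path[OF vp zero] by (simp add: contour_integral_unique)
  have "((\<lambda>z. f z / (z - 0)) has_contour_integral (2 * pi * \<i> * winding_number (g1 +++ g2) 0 * f 0)) (g1 +++ g2)"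
  proof (rule Cauchy_integral_formula_convex_simple[OF U(1) f _ vp])
    show "path_image (g1 +++ g2) \<subseteq> U - {0}"
      using g1(2) g2(2) unfolding path_image_join[OF join] by blast
  qed (use U ends in \<open>simp_all add: interior_open\<close>)
  then have "((\<lambda>z. f z / z) has_contour_integral (2 * pi * \<i> * f 0)) (g1 +++ g2)"
    using wn by simp
  then show "contour_integral g1 (\<lambda>z. f z / z) + contour_integral g2 (\<lambda>z. f z / z) = 2 * pi * \<i> * f 0"
    using contour_integral_join[OF int1 int2 g1(1) g2(1)] by (simp add: contour_integral_unique)
qed

lemma right_semicircle:
  assumes R: "R > 0"
  shows "path_image (part_circlepath 0 R (-pi/2) (pi/2)) \<subseteq> {z. Re z \<ge> 0 \<and> norm z = R}"
    and "pathstart (part_circlepath 0 R (-pi/2) (pi/2)) = - \<i> * of_real R"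
    and "pathfinish (part_circlepath 0 R (-pi/2) (pi/2)) = \<i> * of_real R"
proof -
  show "path_image (part_circlepath 0 R (-pi/2) (pi/2)) \<subseteq> {z. Re z \<ge> 0 \<and> norm z = R}"
    using R by (auto simp: path_image_part_circlepath' closed_segment_eq_real_ivl norm_mult cos_ge_zero)
qed (simp_all only: pathstart_part_circlepath pathfinish_part_circlepath flip: cis_conv_exp,
     simp_all add: complex_eq_iff)

lemma left_semicircle:
  assumes R: "R > 0"
  shows "path_image (part_circlepath 0 R (pi/2) (3*pi/2)) \<subseteq> {z. Re z \<le> 0 \<and> norm z = R}"
    and "pathstart (part_circlepath 0 R (pi/2) (3*pi/2)) = \<i> * of_real R"
    and "pathfinish (part_circlepath 0 R (pi/2) (3*pi/2)) = - \<i> * of_real R"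
proof -
  have "cos t \<le> 0" if "t \<in> {pi/2..3*pi/2}" for t
    using cos_ge_zero[of "t - pi"] that by (simp add: cos_diff)
  then show "path_image (part_circlepath 0 R (pi/2) (3*pi/2)) \<subseteq> {z. Re z \<le> 0 \<and> norm z = R}"
    using R by (auto simp: path_image_part_circlepath' closed_segment_eq_real_ivl norm_mult mult_nonneg_nonpos)
  have "cis (3 * pi / 2) = - \<i>"
    using cis_mult[of pi "pi/2"] by (simp add: field_simps)
  then show "pathfinish (part_circlepath 0 R (pi/2) (3*pi/2)) = - \<i> * of_real R"
    by (simp only: pathfinish_part_circlepath flip: cis_conv_exp) simp
qed (simp_all only: pathstart_part_circlepath pathfinish_part_circlepath flip: cis_conv_exp,
     simp_all add: complex_eq_iff)

text \<open>On the circle \<open>R\<^sup>2 = z * cnj z\<close>, so the numerator is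
  \<open>z * (cnj z + z) / R\<^sup>2 = 2 z Re z / R\<^sup>2\<close>.\<close>

lemma Newman_kernel_norm:
  assumes "norm z = R" "R > 0"
  shows "norm ((1 + z\<^sup>2 / of_real R ^ 2) / z) = 2 * \<bar>Re z\<bar> / R\<^sup>2"
proof -
  have z: "z \<noteq> 0" using assms by auto
  have "z * cnj z = of_real R ^ 2" using assms by (simp add: complex_norm_square[symmetric])
  then have "1 + z\<^sup>2 / of_real R ^ 2 = z * (cnj z + z) / of_real R ^ 2"
    using assms by (simp add: field_simps power2_eq_square)
  then have "(1 + z\<^sup>2 / of_real R ^ 2) / z = of_real (2 * Re z) / of_real (R\<^sup>2)"
    using z by (simp add: complex_add_cnj add.commute)
  then show ?thesis
    by (simp only: norm_divide norm_of_real) (simp add: abs_mult)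
qed

text \<open>The shift of the exponent by 1 places the boundary of convergence for bounded
  coefficients on the imaginary axis, with the series of interest at \<open>z = 0\<close>.\<close>

definition Dirichlet_psum :: "(nat \<Rightarrow> complex) \<Rightarrow> nat \<Rightarrow> complex \<Rightarrow> complex" where
  "Dirichlet_psum e N z = (\<Sum>n\<le>N. e n * of_nat n powr (- z - 1))"

lemma Dirichlet_tail_le:
  assumes e: "\<And>n. norm (e n) \<le> C" and sums: "(\<lambda>n. e n * of_nat n powr (- z - 1)) sums s"
    and z: "Re z > 0" and N: "N > 0"
  shows "norm (s - Dirichlet_psum e N z) \<le> C * (real N powr (- Re z) / Re z)"
proof (rule tendsto_upperbound)
  have C: "C \<ge> 0" using e[of 0] norm_ge_zero order_trans by blast
  show "((\<lambda>M. norm (Dirichlet_psum e M z - Dirichlet_psum e N z)) \<longlongrightarrow> norm (s - Dirichlet_psum e N z)) sequentially"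
    using sums unfolding sums_def_le Dirichlet_psum_def[of e _ z, abs_def] by (intro tendsto_intros)
  show "eventually (\<lambda>M. norm (Dirichlet_psum e M z - Dirichlet_psum e N z) \<le> C * (real N powr (- Re z) / Re z)) sequentially"
    using eventually_ge_at_top[of N]
  proof eventually_elim
    case (elim M)
    have "Dirichlet_psum e M z - Dirichlet_psum e N z = (\<Sum>n\<in>{..M} - {..N}. e n * of_nat n powr (- z - 1))"
      unfolding Dirichlet_psum_def using elim by (intro sum_diff[symmetric]) auto
    also have "{..M} - {..N} = {Suc N..M}" by auto
    also have "norm (\<Sum>n=Suc N..M. e n * of_nat n powr (- z - 1)) \<le> (\<Sum>n=Suc N..M. C * real n powr (- Re z - 1))"
      by (rule sum_norm_le) (use e in \<open>auto simp: norm_mult norm_nat_powr intro!: mult_right_mono\<close>)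
    also have "\<dots> = C * (\<Sum>n=Suc N..M. real n powr (- Re z - 1))"
      by (simp add: sum_distrib_left)
    also have "\<dots> \<le> C * ((real N powr (- Re z) - real M powr (- Re z)) / Re z)"
      using sum_powr_tail_le[OF z N elim] C by (intro mult_left_mono) auto
    also have "\<dots> \<le> C * (real N powr (- Re z) / Re z)"
      using C z by (intro mult_left_mono divide_right_mono) auto
    finally show ?case .
  qed
qed auto

lemma Dirichlet_psum_le:
  assumes e: "\<And>n. norm (e n) \<le> C" and z: "Re z < 0"
  shows "norm (Dirichlet_psum e N z) \<le> C * (real N powr (- Re z) / (- Re z) + real N powr (- Re z - 1))"
proof -
  have C: "C \<ge> 0" using e[of 0] norm_ge_zero order_trans by blast
  have "norm (Dirichlet_psum e N z) \<le> (\<Sum>n\<le>N. C * real n powr (- Re z - 1))"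
    unfolding Dirichlet_psum_def
    by (rule sum_norm_le) (use e in \<open>auto simp: norm_mult norm_nat_powr intro!: mult_right_mono\<close>)
  also have "\<dots> = C * (\<Sum>n\<le>N. real n powr (- Re z - 1))"
    by (simp add: sum_distrib_left)
  also have "\<dots> \<le> C * (real N powr (- Re z) / (- Re z) + real N powr (- Re z - 1))"
    using sum_powr_le[of "- Re z" N] C z by (intro mult_left_mono) auto
  finally show ?thesis .
qed

text \<open>Newman's kernel \<open>N\<^sup>z (1 + z\<^sup>2 / R\<^sup>2) / z\<close> has modulus \<open>2 N\<^sup>x \<bar>x\<bar> / R\<^sup>2\<close> on the circle \<open>\<bar>z\<bar> = R\<close>, which
  cancels the factor \<open>N\<^sup>-\<^sup>x / \<bar>x\<bar>\<close> in the bounds for the tail (right half) and the partial sum (left half).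
  The entire partial sum is integrated over the full circle, while \<open>D\<close>, which need not extend
  far to the left, is integrated over the path \<open>L\<close> there.\<close>

lemma Newman_estimate:
  fixes e :: "nat \<Rightarrow> complex" and C R :: real and N :: nat
  assumes e: "\<And>n. norm (e n) \<le> C" and N: "N > 0" and R: "R > 0"
    and sums: "\<And>z. Re z > 0 \<Longrightarrow> (\<lambda>n. e n * of_nat n powr (- z - 1)) sums D z"
    and U: "convex U" "open U" "0 \<in> U" "{z. Re z \<ge> 0 \<and> norm z = R} \<subseteq> U" and D: "D holomorphic_on U"
    and L: "valid_path L" "path_image L \<subseteq> U \<inter> {z. Re z \<le> 0} - {0}"
      "pathstart L = \<i> * of_real R" "pathfinish L = - \<i> * of_real R"
  defines "I \<equiv> contour_integral L (\<lambda>z. D z * of_nat N powr z * (1 + z\<^sup>2 / of_real R ^ 2) / z)"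
  shows "2 * pi * norm (D 0 - Dirichlet_psum e N 0) \<le> 4 * pi * C / R + 2 * pi * C / real N + norm I"
proof -
  have C: "C \<ge> 0" using e[of 0] norm_ge_zero order_trans by blast
  let ?G1 = "part_circlepath 0 R (-pi/2) (pi/2)" and ?G2 = "part_circlepath 0 R (pi/2) (3*pi/2)"
  define k where "k = (\<lambda>z::complex. of_nat N powr z * (1 + z\<^sup>2 / of_real R ^ 2))"
  \<comment> \<open>Because of this value Cauchy's formula returns \<open>D 0\<close> and the
    partial sum at 0 themselves.\<close>
  have k0: "k 0 = 1" using N by (simp add: k_def)
  have k: "norm (k z / z) = real N powr Re z * (2 * \<bar>Re z\<bar> / R\<^sup>2)" if "norm z = R" for z
  proof -
    have "norm (k z / z) = norm (of_nat N powr z :: complex) * norm ((1 + z\<^sup>2 / of_real R ^ 2) / z)"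
      by (simp add: k_def norm_mult norm_divide)
    then show ?thesis using Newman_kernel_norm[OF that R] by (simp add: norm_nat_powr)
  qed
  have hk: "k holomorphic_on A" for A
    unfolding k_def using R by (intro holomorphic_intros) auto
  have fD: "(\<lambda>z. D z * k z) holomorphic_on U" by (intro holomorphic_on_mult D hk)
  have fS: "(\<lambda>z. Dirichlet_psum e N z * k z) holomorphic_on UNIV"
    unfolding Dirichlet_psum_def by (intro holomorphic_on_mult holomorphic_intros hk)
  note r = right_semicircle[OF R] and l = left_semicircle[OF R]
  have G1: "path_image ?G1 \<subseteq> U \<inter> {z. Re z \<ge> 0} - {0}" using r(1) U(4) R by auto
  have G1': "path_image ?G1 \<subseteq> UNIV \<inter> {z. Re z \<ge> 0} - {0}" using G1 by blast
  have G2: "path_image ?G2 \<subseteq> UNIV \<inter> {z. Re z \<le> 0} - {0}" using l(1) R by auto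
  note cD = Cauchy_integral_two_halves[OF U(1-3) fD valid_path_part_circlepath G1 L(1,2) r(2,3) L(3,4) R]
  note cS = Cauchy_integral_two_halves[OF convex_UNIV open_UNIV UNIV_I fS valid_path_part_circlepath G1'
      valid_path_part_circlepath G2 r(2,3) l(2,3) R]
  define J1 where "J1 = contour_integral ?G1 (\<lambda>z. D z * k z / z - Dirichlet_psum e N z * k z / z)"
  define J2 where "J2 = contour_integral ?G2 (\<lambda>z. Dirichlet_psum e N z * k z / z)"
  have "I = contour_integral L (\<lambda>z. D z * k z / z)"
    by (simp add: I_def k_def mult.assoc)
  moreover have "J1 = contour_integral ?G1 (\<lambda>z. D z * k z / z) - contour_integral ?G1 (\<lambda>z. Dirichlet_psum e N z * k z / z)"
    unfolding J1_def by (rule contour_integral_diff[OF cD(2) cS(2)])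
  moreover have "2 * pi * \<i> * D 0 = contour_integral ?G1 (\<lambda>z. D z * k z / z) + contour_integral L (\<lambda>z. D z * k z / z)"
    using cD(1) by (simp add: k0)
  moreover have "2 * pi * \<i> * Dirichlet_psum e N 0 = contour_integral ?G1 (\<lambda>z. Dirichlet_psum e N z * k z / z) + J2"
    using cS(1) by (simp add: J2_def k0)
  ultimately have eq: "2 * pi * \<i> * (D 0 - Dirichlet_psum e N 0) = J1 + I - J2"
    by (simp only: right_diff_distrib) simp
  \<comment> \<open>The bounds for tail and partial sum divide by \<open>Re z\<close>, so they fail
    at the two ends of each semicircle. The integral estimate tolerates finitely many exceptional
    points.\<close>
  have edge: "Re z \<noteq> 0" if "norm z = R" "z \<notin> {\<i> * of_real R, - \<i> * of_real R}" for z
  proof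
    assume "Re z = 0"
    with that have "\<bar>Im z\<bar> = R" by (simp add: cmod_eq_Im)
    with \<open>Re z = 0\<close> that(2) show False by (auto simp: complex_eq_iff abs_if split: if_splits)
  qed
  have J1: "norm J1 \<le> 2 * C / R\<^sup>2 * R * (pi/2 - (-pi/2))"
    unfolding J1_def
  proof (rule contour_integral_bound_part_circlepath_strong[OF _ _ _ R])
    show "(\<lambda>z. D z * k z / z - Dirichlet_psum e N z * k z / z) contour_integrable_on ?G1"
      by (rule contour_integrable_diff[OF cD(2) cS(2)])
    fix z assume "z \<in> path_image ?G1 - {\<i> * of_real R, - \<i> * of_real R}"
    then have z: "norm z = R" "Re z > 0" using r(1) edge[of z] by force+
    have "D z * k z / z - Dirichlet_psum e N z * k z / z = (D z - Dirichlet_psum e N z) * (k z / z)"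
      by (simp add: left_diff_distrib diff_divide_distrib)
    then have "norm (D z * k z / z - Dirichlet_psum e N z * k z / z)
        = norm (D z - Dirichlet_psum e N z) * (real N powr Re z * (2 * Re z / R\<^sup>2))"
      using k[OF z(1)] z by (simp only: norm_mult abs_of_pos)
    also have "\<dots> \<le> C * (real N powr (- Re z) / Re z) * (real N powr Re z * (2 * Re z / R\<^sup>2))"
      using Dirichlet_tail_le[OF e sums[OF z(2)] z(2) N] z by (intro mult_right_mono) auto
    also have "\<dots> = C * (real N powr (- Re z) * real N powr Re z) * (2 / R\<^sup>2)"
      using z by simp
    also have "\<dots> = 2 * C / R\<^sup>2"
      using N by (simp flip: powr_add)
    finally show "norm (D z * k z / z - Dirichlet_psum e N z * k z / z) \<le> 2 * C / R\<^sup>2" .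
  qed (use C in auto)
  have J2: "norm J2 \<le> 2 * C / R\<^sup>2 * (1 + R / N) * R * (3*pi/2 - pi/2)"
    unfolding J2_def
  proof (rule contour_integral_bound_part_circlepath_strong[OF cS(3) _ _ R])
    fix z assume "z \<in> path_image ?G2 - {\<i> * of_real R, - \<i> * of_real R}"
    then have z: "norm z = R" "Re z < 0" using l(1) edge[of z] by force+
    define y where "y = - Re z"
    have y: "y > 0" "y \<le> R" using z abs_Re_le_cmod[of z] by (auto simp: y_def)
    have "norm (Dirichlet_psum e N z * k z / z) = norm (Dirichlet_psum e N z) * (real N powr (- y) * (2 * y / R\<^sup>2))"
      using k[OF z(1)] z by (simp only: norm_mult times_divide_eq_right[symmetric]) (simp add: y_def)
    also have "\<dots> \<le> C * (real N powr y / y + real N powr (y - 1)) * (real N powr (- y) * (2 * y / R\<^sup>2))"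
      using Dirichlet_psum_le[of e C, OF e z(2), of N] y unfolding y_def[symmetric]
      by (intro mult_right_mono) auto
    also have "\<dots> = 2 * C / R\<^sup>2 * (real N powr y * real N powr (- y) + y * (real N powr (y - 1) * real N powr (- y)))"
      using y by (simp add: field_simps)
    also have "real N powr y * real N powr (- y) = 1"
      using N by (simp flip: powr_add)
    also have "real N powr (y - 1) * real N powr (- y) = real N powr (-1)"
      by (simp flip: powr_add)
    also have "\<dots> = 1 / N"
      by (simp add: powr_minus_divide)
    \<comment> \<open>The summand with \<open>1 / N\<close> stems from the separate last term in the
      bound of the partial sum. Over the length \<open>pi * R\<close> it produces
      \<open>2 * pi * C / N\<close>.\<close>
    also have "2 * C / R\<^sup>2 * (1 + y * (1 / N)) \<le> 2 * C / R\<^sup>2 * (1 + R / N)"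
      using y C N by (intro mult_left_mono) (auto simp: divide_right_mono)
    finally show "norm (Dirichlet_psum e N z * k z / z) \<le> 2 * C / R\<^sup>2 * (1 + R / N)" .
  qed (use C R in auto)
  have "2 * pi * norm (D 0 - Dirichlet_psum e N 0) = norm (2 * pi * \<i> * (D 0 - Dirichlet_psum e N 0))"
    by (simp add: norm_mult)
  also have "\<dots> \<le> norm J1 + norm I + norm J2"
    unfolding eq by (intro order_trans[OF norm_triangle_ineq4] add_right_mono norm_triangle_ineq)
  also have "\<dots> \<le> 2 * C / R\<^sup>2 * R * (pi/2 - (-pi/2)) + norm I + 2 * C / R\<^sup>2 * (1 + R / N) * R * (3*pi/2 - pi/2)"
    using J1 J2 by (intro add_mono) auto
  also have "\<dots> = 4 * pi * C / R + 2 * pi * C / real N + norm I"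
    using R N by (simp add: field_simps power2_eq_square)
  finally show ?thesis .
qed

text \<open>On the two horizontal sides \<open>N powr z\<close> is only bounded by 1, but their
  length is \<open>\<delta>\<close>. The vertical side is long, but there \<open>N powr z\<close>
  has modulus \<open>N powr (-\<delta>)\<close>. So the first part is small with
  \<open>\<delta>\<close>, and for fixed \<open>\<delta>\<close> the second is small with large
  \<open>N\<close>.\<close>

lemma left_detour_bound:
  fixes D :: "complex \<Rightarrow> complex" and N :: nat and R \<delta> B :: real
  assumes N: "N > 0" and \<delta>: "0 < \<delta>" "\<delta> \<le> R" and V: "open V" "cbox (Complex (-\<delta>) (-R)) (Complex 0 R) \<subseteq> V"
    and D: "D holomorphic_on V"
    and B: "\<And>z. z \<in> cbox (Complex (-\<delta>) (-R)) (Complex 0 R) \<Longrightarrow> norm (D z) \<le> B"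
  defines "L \<equiv> linepath (\<i> * of_real R) (Complex (-\<delta>) R) +++ linepath (Complex (-\<delta>) R) (Complex (-\<delta>) (-R))
      +++ linepath (Complex (-\<delta>) (-R)) (- \<i> * of_real R)"
  shows "valid_path L" "path_image L \<subseteq> cbox (Complex (-\<delta>) (-R)) (Complex 0 R) - {0}"
    "pathstart L = \<i> * of_real R" "pathfinish L = - \<i> * of_real R"
    "norm (contour_integral L (\<lambda>z. D z * of_nat N powr z * (1 + z\<^sup>2 / of_real R ^ 2) / z))
       \<le> 10 * B * \<delta> / R + 10 * B * R / \<delta> * real N powr (-\<delta>)"
proof -
  let ?Q = "cbox (Complex (-\<delta>) (-R)) (Complex 0 R)"
  let ?h = "\<lambda>z. D z * of_nat N powr z * (1 + z\<^sup>2 / of_real R ^ 2) / z"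
  let ?s1 = "closed_segment (\<i> * of_real R) (Complex (-\<delta>) R)"
  let ?s2 = "closed_segment (Complex (-\<delta>) R) (Complex (-\<delta>) (-R))"
  let ?s3 = "closed_segment (Complex (-\<delta>) (-R)) (- \<i> * of_real R)"
  have R: "R > 0" using \<delta> by simp
  have ends: "\<i> * of_real R = Complex 0 R" "- \<i> * of_real R = Complex 0 (-R)"
    by (auto simp: complex_eq_iff)
  have sub: "?s1 \<subseteq> ?Q" "?s2 \<subseteq> ?Q" "?s3 \<subseteq> ?Q"
    unfolding ends by (rule closed_segment_subset; use \<delta> R in \<open>simp add: in_cbox_complex_iff\<close>)+
  have s1: "Im z = R" if "z \<in> ?s1" for z
    using that unfolding ends in_segment by (elim conjE exE) (simp add: left_diff_distrib)
  have s2: "Re z = -\<delta>" if "z \<in> ?s2" for z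
    using that unfolding in_segment by (elim conjE exE) (simp add: left_diff_distrib)
  have s3: "Im z = -R" if "z \<in> ?s3" for z
    using that unfolding ends in_segment by (elim conjE exE) (simp add: left_diff_distrib)
  have nz: "0 \<notin> ?s1" "0 \<notin> ?s2" "0 \<notin> ?s3"
    using s1[of 0] s2[of 0] s3[of 0] R \<delta> by auto
  show valid: "valid_path L" by (auto simp: L_def)
  show "pathstart L = \<i> * of_real R" "pathfinish L = - \<i> * of_real R" by (simp_all add: L_def)
  show "path_image L \<subseteq> ?Q - {0}"
    using sub nz by (auto simp: L_def path_image_join)
  have B0: "B \<ge> 0" using B[of 0] R \<delta> by (auto simp: in_cbox_complex_iff intro: order_trans[OF norm_ge_zero])
  \<comment> \<open>In the box \<open>norm z \<le> 2R\<close>, so the kernel factor is at most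
    \<open>1 + 4\<close>. The lower bound \<open>r\<close> will be \<open>R\<close> on the
    horizontal sides and \<open>\<delta>\<close> on the vertical one.\<close>
  have bound: "norm (?h z) \<le> B * real N powr Re z * (5 / r)" if z: "z \<in> ?Q" and r: "0 < r" "r \<le> norm z" for z r
  proof -
    have "norm z \<le> \<bar>Re z\<bar> + \<bar>Im z\<bar>" by (rule cmod_le)
    also have "\<dots> \<le> 2 * R" using z \<delta> by (auto simp: in_cbox_complex_iff)
    finally have "norm z ^ 2 \<le> (2 * R) ^ 2" by (intro power_mono) auto
    then have "norm (z\<^sup>2 / of_real R ^ 2) \<le> 4"
      using R by (simp add: norm_divide norm_power field_simps)
    then have "norm (1 + z\<^sup>2 / of_real R ^ 2) \<le> 5"
      using norm_triangle_ineq[of 1 "z\<^sup>2 / of_real R ^ 2"] by simp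
    then have "norm (1 + z\<^sup>2 / of_real R ^ 2) / norm z \<le> 5 / r"
      using r by (intro frac_le) auto
    then have "(norm (D z) * real N powr Re z) * (norm (1 + z\<^sup>2 / of_real R ^ 2) / norm z) \<le> (B * real N powr Re z) * (5 / r)"
      using B[OF z] B0 by (intro mult_mono mult_nonneg_nonneg) auto
    then show ?thesis by (simp add: norm_mult norm_divide norm_nat_powr)
  qed
  have hol: "?h holomorphic_on V - {0}"
    using R by (intro holomorphic_intros holomorphic_on_subset[OF D]) auto
  have int: "?h contour_integrable_on (linepath a b)" if "closed_segment a b \<subseteq> ?Q" "0 \<notin> closed_segment a b" for a b
    using that V by (intro contour_integrable_holomorphic_simple[OF hol]) auto
  have hor: "norm (?h z) \<le> 5 * B / R" if "z \<in> ?Q" "\<bar>Im z\<bar> = R" for z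
  proof -
    have "norm (?h z) \<le> B * real N powr Re z * (5 / R)"
      using that abs_Im_le_cmod[of z] R by (intro bound) auto
    also have "\<dots> \<le> B * 1 * (5 / R)"
      using that N B0 R powr_mono[of "Re z" 0 "real N"] by (intro mult_mono mult_nonneg_nonneg) (auto simp: in_cbox_complex_iff)
    finally show ?thesis by (simp add: mult_ac)
  qed
  have 1: "norm (contour_integral (linepath (\<i> * of_real R) (Complex (-\<delta>) R)) ?h) \<le> 5 * B / R * \<delta>"
  proof -
    have "norm (contour_integral (linepath (\<i> * of_real R) (Complex (-\<delta>) R)) ?h) \<le> 5 * B / R * norm (Complex (-\<delta>) R - \<i> * of_real R)"
      using int sub nz s1 hor B0 R by (intro contour_integral_bound_linepath) auto
    then show ?thesis using \<delta> by (simp add: cmod_def)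
  qed
  have 3: "norm (contour_integral (linepath (Complex (-\<delta>) (-R)) (- \<i> * of_real R)) ?h) \<le> 5 * B / R * \<delta>"
  proof -
    have "norm (contour_integral (linepath (Complex (-\<delta>) (-R)) (- \<i> * of_real R)) ?h) \<le> 5 * B / R * norm (- \<i> * of_real R - Complex (-\<delta>) (-R))"
      using int sub nz s3 hor B0 R by (intro contour_integral_bound_linepath) auto
    then show ?thesis using \<delta> by (simp add: cmod_def)
  qed
  have 2: "norm (contour_integral (linepath (Complex (-\<delta>) R) (Complex (-\<delta>) (-R))) ?h) \<le> B * real N powr (-\<delta>) * (5 / \<delta>) * (2 * R)"
  proof -
    have "norm (?h z) \<le> B * real N powr (-\<delta>) * (5 / \<delta>)" if "z \<in> ?s2" for z
      using bound[of z \<delta>] that sub s2[OF that] \<delta> abs_Re_le_cmod[of z] by auto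
    then have "norm (contour_integral (linepath (Complex (-\<delta>) R) (Complex (-\<delta>) (-R))) ?h)
        \<le> B * real N powr (-\<delta>) * (5 / \<delta>) * norm (Complex (-\<delta>) (-R) - Complex (-\<delta>) R)"
      using int sub nz B0 \<delta> by (intro contour_integral_bound_linepath) auto
    also have "norm (Complex (-\<delta>) (-R) - Complex (-\<delta>) R) = 2 * R"
      using R by (simp add: cmod_eq_Im)
    finally show ?thesis .
  qed
  have "contour_integral L ?h = contour_integral (linepath (\<i> * of_real R) (Complex (-\<delta>) R)) ?h +
     (contour_integral (linepath (Complex (-\<delta>) R) (Complex (-\<delta>) (-R))) ?h +
      contour_integral (linepath (Complex (-\<delta>) (-R)) (- \<i> * of_real R)) ?h)"
    unfolding L_def using int[OF sub(1) nz(1)] int[OF sub(2) nz(2)] int[OF sub(3) nz(3)]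
    by (subst contour_integral_join; (subst contour_integral_join)?; (simp add: contour_integrable_joinI)?)
  then have "norm (contour_integral L ?h) \<le> 5 * B / R * \<delta> + (B * real N powr (-\<delta>) * (5 / \<delta>) * (2 * R) + 5 * B / R * \<delta>)"
    using 1 2 3 by (metis (no_types, lifting) add_mono norm_triangle_le)
  then show "norm (contour_integral L ?h) \<le> 10 * B * \<delta> / R + 10 * B * R / \<delta> * real N powr (-\<delta>)"
    by (simp add: mult_ac)
qed

theorem Newman_tauberian:
  fixes e :: "nat \<Rightarrow> complex"
  assumes e: "\<And>n. norm (e n) \<le> C"
    and sums: "\<And>z. Re z > 0 \<Longrightarrow> (\<lambda>n. e n * of_nat n powr (- z - 1)) sums D z"
    and W: "open W" "{z. Re z \<ge> 0} \<subseteq> W" and D: "D holomorphic_on W"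
  shows "(\<lambda>N. Dirichlet_psum e N 0) \<longlonglongrightarrow> D 0"
proof (rule tendstoI)
  fix \<epsilon> :: real assume \<epsilon>: "\<epsilon> > 0"
  have C: "C \<ge> 0" using e[of 0] norm_ge_zero order_trans by blast
  define R where "R = 4 * pi * C / \<epsilon> + 1"
  have R: "R > 0" "4 * pi * C / R < \<epsilon>"
  proof -
    show "R > 0" unfolding R_def using C \<epsilon> by (intro add_nonneg_pos) auto
    then show "4 * pi * C / R < \<epsilon>" using \<epsilon> by (simp add: R_def field_simps)
  qed
  have "cbox (Complex 0 (-R)) (Complex R R) \<subseteq> W"
    using W(2) by (auto simp: in_cbox_complex_iff)
  from compact_subset_open_imp_ball_epsilon_subset[OF compact_cbox W(1) this]
  obtain r where r: "r > 0" "(\<Union>x\<in>cbox (Complex 0 (-R)) (Complex R R). ball x r) \<subseteq> W" by blast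
  \<comment> \<open>Cauchy's formula is applied on a convex open set, so \<open>W\<close> is
    replaced by a slightly enlarged rectangle. Clamping the coordinates of a point of
    \<open>U\<close> moves each by less than \<open>r / 2\<close>, hence the point by less than
    \<open>r\<close>.\<close>
  define U where "U = box (Complex (-r/2) (-R-r/2)) (Complex (R+r/2) (R+r/2))"
  have "U \<subseteq> W"
  proof
    fix z assume z: "z \<in> U"
    let ?x = "Complex (max 0 (min R (Re z))) (max (-R) (min R (Im z)))"
    have "norm (?x - z) \<le> \<bar>Re (?x - z)\<bar> + \<bar>Im (?x - z)\<bar>" by (rule cmod_le)
    also have "\<dots> < r" using z R r unfolding U_def by (auto simp: in_box_complex_iff max_def min_def)
    finally have "z \<in> ball ?x r" by (simp add: dist_norm)
    moreover have "?x \<in> cbox (Complex 0 (-R)) (Complex R R)" using R by (auto simp: in_cbox_complex_iff)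
    ultimately show "z \<in> W" using r by blast
  qed
  then have DU: "D holomorphic_on U" using D holomorphic_on_subset by blast
  have U: "convex U" "open U" by (simp_all add: U_def open_box)
  have U0: "0 \<in> U" using R r by (simp add: U_def in_box_complex_iff)
  have UR: "{z. Re z \<ge> 0 \<and> norm z = R} \<subseteq> U"
  proof
    fix z assume "z \<in> {z. Re z \<ge> 0 \<and> norm z = R}"
    then show "z \<in> U" using abs_Re_le_cmod[of z] abs_Im_le_cmod[of z] r
      by (auto simp: U_def in_box_complex_iff)
  qed
  define \<delta>0 where "\<delta>0 = min R (r / 4)"
  have \<delta>0: "\<delta>0 > 0" "\<delta>0 \<le> R" "\<delta>0 < r / 2" using R r by (auto simp: \<delta>0_def)
  let ?Q = "\<lambda>\<delta>. cbox (Complex (-\<delta>) (-R)) (Complex 0 R)"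
  have QU: "?Q \<delta>0 \<subseteq> U" unfolding U_def using \<delta>0 R r by (auto simp: in_cbox_complex_iff in_box_complex_iff)
  have "compact (D ` ?Q \<delta>0)"
    using DU QU by (intro compact_continuous_image compact_cbox holomorphic_on_imp_continuous_on holomorphic_on_subset[OF DU])
  \<comment> \<open>The bound is taken on the larger box, so it survives shrinking
    \<open>\<delta>\<close> in terms of \<open>B\<close>.\<close>
  then obtain B where B: "B > 0" "\<And>z. z \<in> ?Q \<delta>0 \<Longrightarrow> norm (D z) \<le> B"
    using bounded_pos[of "D ` ?Q \<delta>0"] compact_imp_bounded by auto
  define \<delta> where "\<delta> = min \<delta>0 (\<epsilon> * R / (20 * B))"
  have \<delta>: "\<delta> > 0" "\<delta> \<le> \<delta>0" "\<delta> \<le> R" using \<delta>0 \<epsilon> R B by (auto simp: \<delta>_def)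
  have "\<delta> \<le> \<epsilon> * R / (20 * B)" by (simp add: \<delta>_def)
  then have "10 * B * \<delta> / R \<le> \<epsilon> / 2" using B(1) R(1) by (simp add: field_simps)
  then have \<delta>': "10 * B * \<delta> / R < \<epsilon>" using \<epsilon> by linarith
  have Q: "?Q \<delta> \<subseteq> ?Q \<delta>0" using \<delta> by (auto simp: in_cbox_complex_iff)
  have "(\<lambda>N. 2 * pi * C / real N + 10 * B * R / \<delta> * real N powr (-\<delta>)) \<longlonglongrightarrow> 0 + 10 * B * R / \<delta> * 0"
    using \<delta>(1) by (intro tendsto_add tendsto_mult tendsto_const tendsto_neg_powr filterlim_real_sequentially
        tendsto_divide_0[OF tendsto_const] filterlim_at_top_imp_at_infinity) auto
  then have "eventually (\<lambda>N. 2 * pi * C / real N + 10 * B * R / \<delta> * real N powr (-\<delta>) < \<epsilon>) sequentially"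
    using \<epsilon> by (intro order_tendstoD(2)) auto
  then show "eventually (\<lambda>N. dist (Dirichlet_psum e N 0) (D 0) < \<epsilon>) sequentially"
    using eventually_gt_at_top[of 0]
  proof eventually_elim
    case (elim N)
    let ?L = "linepath (\<i> * of_real R) (Complex (-\<delta>) R) +++ linepath (Complex (-\<delta>) R) (Complex (-\<delta>) (-R))
      +++ linepath (Complex (-\<delta>) (-R)) (- \<i> * of_real R)"
    note L = left_detour_bound[OF elim(2) \<delta>(1,3) U(2) order_trans[OF Q QU] DU B(2)[OF subsetD[OF Q]]]
    have "path_image ?L \<subseteq> U \<inter> {z. Re z \<le> 0} - {0}"
      using L(2) Q QU by (force simp: in_cbox_complex_iff)
    from Newman_estimate[of e C N R D U ?L, OF e elim(2) R(1) sums U U0 UR DU L(1) this L(3,4)]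
    \<comment> \<open>One \<open>\<epsilon>\<close> for the two semicircles, one for the horizontal
      sides, and one for everything that vanishes as \<open>N\<close> grows.\<close>
    have "2 * pi * norm (D 0 - Dirichlet_psum e N 0) < 3 * \<epsilon>"
      using L(5) R(2) \<delta>' elim(1) by linarith
    also have "\<dots> < 2 * pi * \<epsilon>" using pi_gt3 \<epsilon> by simp
    finally show ?case by (simp add: dist_norm norm_minus_commute)
  qed
qed

section \<open>The prime number theorem\<close>

definition psi_err :: "nat \<Rightarrow> complex" where
  "psi_err n = of_real (psi n - real n)"

lemma norm_psi_err_le: "norm (psi_err n) \<le> 4 * real n"
  using psi_le[of n] psi_nonneg[of n] unfolding psi_err_def norm_of_real by (simp add: abs_le_iff)

text \<open>The difference of \<open>n powr (-s)\<close> and \<open>(n + 1) powr (-s)\<close> is \<open>s n powr (- s - 1)\<close> minus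
  \<open>tele (s + 1) n\<close>, and the series of these error terms still converges for \<open>Re s > 0\<close>.\<close>

lemma Mangoldt_zeta_summation_by_parts:
  "s * (\<Sum>n\<le>N. psi_err n * of_nat n powr (- s - 1)) =
     (\<Sum>n\<le>N. (mangoldt n - 1) * of_nat n powr (-s)) - psi_err N * of_nat (Suc N) powr (-s)
     + (\<Sum>n\<le>N. psi_err n * tele (s + 1) n)"
proof (induction N)
  case (Suc N)
  \<comment> \<open>The ring identity behind the induction step, with \<open>a\<close> for the new
    error, \<open>p\<close> and \<open>q\<close> for the two consecutive powers, and
    \<open>t\<close> for the new \<open>tele\<close> term.\<close>
  have step: "s * (S + a * u) = (T + (m - 1) * p) - a * q + (V + a * t)"
    if "s * S = T - (a - (m - 1)) * p + V" "t = s * u - p + q" for S T V a m p q t u :: complex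
    unfolding distrib_left that by (simp add: algebra_simps)
  have "psi_err N = psi_err (Suc N) - (mangoldt (Suc N) - 1)"
    by (simp add: psi_err_def)
  moreover have "tele (s + 1) (Suc N) = s * of_nat (Suc N) powr (- s - 1) - of_nat (Suc N) powr (-s)
      + of_nat (Suc (Suc N)) powr (-s)"
    by (simp add: tele_def)
  ultimately show ?case
    using Suc unfolding sum.atMost_Suc by (intro step) simp_all
qed (simp add: psi_err_def)

definition psi_series :: "complex \<Rightarrow> complex" where
  "psi_series s = (\<Sum>n. psi_err n * tele (s + 1) n)"

text \<open>Chebyshev's bound makes the weights \<open>O(n)\<close>, and
  \<open>tele (s + 1) n\<close> decays like \<open>n powr (- Re s - 2)\<close>. The correction is
  therefore harmless well beyond the line \<open>Re s = 1\<close>.\<close>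

lemma holomorphic_psi_series: "psi_series holomorphic_on {s. Re s > 0}"
  and summable_psi_series: "Re s > 0 \<Longrightarrow> summable (\<lambda>n. psi_err n * tele (s + 1) n)"
proof -
  have b: "norm (psi_err n) \<le> 4 * real n powr 1" for n
    using norm_psi_err_le[of n] by simp
  have "(\<lambda>s. (\<Sum>n. psi_err n * tele s n)) \<circ> (\<lambda>s. s + 1) holomorphic_on {s. Re s > 0}"
    by (rule holomorphic_on_compose_gen[OF _ tele_sums(1)[OF b]]) (auto intro!: holomorphic_intros)
  then show "psi_series holomorphic_on {s. Re s > 0}"
    by (simp add: psi_series_def[abs_def] o_def)
  show "summable (\<lambda>n. psi_err n * tele (s + 1) n)" if "Re s > 0"
    using tele_sums(2)[OF b, of "s + 1"] that by simp
qed

text \<open>The limit of the partial summation. Its boundary term is of order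
  \<open>N powr (1 - Re s)\<close> by Chebyshev's bound and disappears for
  \<open>Re s > 1\<close>.\<close>

lemma psi_err_sums:
  assumes s: "Re s > 1"
  shows "(\<lambda>n. psi_err n * of_nat n powr (- s - 1)) sums
    ((Mangoldt_series s - zeta s + psi_series s) / s)"
proof -
  have s0: "s \<noteq> 0" using s by auto
  have "(\<lambda>n. mangoldt n * of_nat n powr (-s) - of_nat n powr (-s)) sums (Mangoldt_series s - zeta s)"
    unfolding Mangoldt_series_def zeta_def
    by (intro sums_diff summable_sums summable_norm_cancel[OF summable_mangoldt]
        summable_norm_cancel[OF summable_nat_powr] s)
  then have 1: "(\<lambda>N. \<Sum>n\<le>N. (mangoldt n - 1) * of_nat n powr (-s)) \<longlonglongrightarrow> Mangoldt_series s - zeta s"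
    by (simp add: sums_def_le left_diff_distrib)
  have 2: "(\<lambda>N. psi_err N * of_nat (Suc N) powr (-s)) \<longlonglongrightarrow> 0"
  proof (rule Lim_null_comparison)
    show "eventually (\<lambda>N. norm (psi_err N * of_nat (Suc N) powr (-s)) \<le> 4 * real N powr (1 - Re s)) sequentially"
      using eventually_gt_at_top[of 0]
    proof eventually_elim
      case (elim N)
      have "norm (psi_err N * of_nat (Suc N) powr (-s)) \<le> (4 * real N) * real N powr (- Re s)"
        unfolding norm_mult norm_nat_powr using norm_psi_err_le[of N] s elim
        by (intro mult_mono) (auto intro!: powr_mono2')
      also have "\<dots> = 4 * (real N powr 1 * real N powr (- Re s))" by simp
      also have "real N powr 1 * real N powr (- Re s) = real N powr (1 - Re s)"
        by (simp only: powr_add[symmetric]) simp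
      finally show ?case .
    qed
    have "(\<lambda>N. 4 * real N powr (1 - Re s)) \<longlonglongrightarrow> 4 * 0"
      using s by (intro tendsto_mult tendsto_const tendsto_neg_powr filterlim_real_sequentially) auto
    then show "(\<lambda>N. 4 * real N powr (1 - Re s)) \<longlonglongrightarrow> 0" by simp
  qed
  have 3: "(\<lambda>N. \<Sum>n\<le>N. psi_err n * tele (s + 1) n) \<longlonglongrightarrow> psi_series s"
    using summable_sums[OF summable_psi_series[of s]] s by (simp add: sums_def_le psi_series_def)
  have "(\<lambda>N. ((\<Sum>n\<le>N. (mangoldt n - 1) * of_nat n powr (-s)) - psi_err N * of_nat (Suc N) powr (-s)
     + (\<Sum>n\<le>N. psi_err n * tele (s + 1) n)) / s) \<longlonglongrightarrow> (Mangoldt_series s - zeta s - 0 + psi_series s) / s"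
    using s0 by (intro tendsto_divide tendsto_add tendsto_diff 1 2 3 tendsto_const)
  then show ?thesis
    unfolding sums_def_le Mangoldt_zeta_summation_by_parts[symmetric] using s0 by simp
qed

text \<open>\<open>1 / (s - 1) - \<zeta>(s)\<close> with the removable singularity at \<open>1\<close> filled in.\<close>

definition zeta_pole_free :: "complex \<Rightarrow> complex" where
  "zeta_pole_free s = (if s = 1 then deriv (\<lambda>s. 1 - Zeta_reg s) 1 else (1 - Zeta_reg s) / (s - 1))"

text \<open>The numerator vanishes at 1 because \<open>Zeta_reg 1 = 1\<close>, so the singularity of
  the quotient is removable.\<close>

lemma holomorphic_zeta_pole_free: "zeta_pole_free holomorphic_on {s. Re s > 0}"
proof (rule pole_theorem_open_0[where g = "\<lambda>s. 1 - Zeta_reg s" and a = 1])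
  show "(\<lambda>s. 1 - Zeta_reg s) holomorphic_on {s. Re s > 0}"
    by (intro holomorphic_intros holomorphic_Zeta_reg)
qed (auto simp: zeta_pole_free_def open_halfspace_Re_gt)

text \<open>Both -zeta'/zeta and zeta have residue 1 at \<open>s = 1\<close>. Grouping the polar
  part \<open>1 / (s - 1)\<close> of the former with -zeta cancels the poles and leaves
  \<open>- Z' / Z\<close> for \<open>Z = Zeta_reg\<close>, which is regular wherever
  \<open>Z\<close> has no zero.\<close>

definition psi_continuation :: "complex \<Rightarrow> complex" where
  "psi_continuation s = (zeta_pole_free s - deriv Zeta_reg s / Zeta_reg s + psi_series s) / s"

lemma holomorphic_psi_continuation:
  "psi_continuation holomorphic_on {s. Re s > 0 \<and> Zeta_reg s \<noteq> 0}"
proof -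
  let ?V = "{s. Re s > 0 \<and> Zeta_reg s \<noteq> 0}"
  have sub: "?V \<subseteq> {s. Re s > 0}" by auto
  have "deriv Zeta_reg holomorphic_on {s. Re s > 0}"
    by (intro holomorphic_deriv holomorphic_Zeta_reg open_halfspace_Re_gt)
  then show ?thesis unfolding psi_continuation_def[abs_def]
    by (intro holomorphic_on_divide holomorphic_on_add holomorphic_on_diff holomorphic_on_ident
        holomorphic_on_subset[OF _ sub] holomorphic_zeta_pole_free holomorphic_Zeta_reg holomorphic_psi_series) auto
qed

lemma open_Zeta_reg_nonzero: "open {s. Re s > 0 \<and> Zeta_reg s \<noteq> 0}"
proof -
  have "open ({s. Re s > 0} \<inter> Zeta_reg -` (- {0}))"
    by (intro continuous_open_preimage holomorphic_on_imp_continuous_on[OF holomorphic_Zeta_reg]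
        open_halfspace_Re_gt open_Compl) auto
  also have "{s. Re s > 0} \<inter> Zeta_reg -` (- {0}) = {s. Re s > 0 \<and> Zeta_reg s \<noteq> 0}" by auto
  finally show ?thesis .
qed

lemma psi_continuation_eq:
  assumes s: "Re s > 1"
  shows "psi_continuation s = (Mangoldt_series s - zeta s + psi_series s) / s"
proof -
  have s1: "s - 1 \<noteq> 0" "s \<noteq> 1" using s by auto
  have "Mangoldt_series s = 1 / (s - 1) - deriv Zeta_reg s / Zeta_reg s"
    using s by (intro Mangoldt_series_eq Zeta_reg_nonzero) simp_all
  moreover have "zeta s = Zeta_reg s / (s - 1)"
    using s1 by (simp add: Zeta_reg_eq[OF s])
  moreover have "zeta_pole_free s = 1 / (s - 1) - Zeta_reg s / (s - 1)"
    using s1 by (simp add: zeta_pole_free_def diff_divide_distrib)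
  ultimately show ?thesis by (simp add: psi_continuation_def)
qed

theorem summable_psi_minus_id: "summable (\<lambda>n. (psi n - real n) / real n ^ 2)"
proof -
  \<comment> \<open>One factor \<open>n\<close> of the denominator \<open>n\<^sup>2\<close> makes
    the coefficients bounded; the other is the \<open>n powr (- z - 1)\<close> of the series at
    \<open>z = 0\<close>. Hence the substitution \<open>s = z + 1\<close>.\<close>
  define e where "e = (\<lambda>n. psi_err n / of_nat n)"
  have e: "norm (e n) \<le> 4" for n
    using norm_psi_err_le[of n] by (cases "n = 0") (auto simp: e_def norm_divide divide_le_eq)
  have eq: "e n * of_nat n powr (- z - 1) = psi_err n * of_nat n powr (- (z + 1) - 1)" for n z
  proof (cases "n = 0")
    case False
    have "- z - 1 = 1 + (- (z + 1) - 1)" by simp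
    then have "of_nat n powr (- z - 1) = (of_nat n powr (1 + (- (z + 1) - 1)) :: complex)"
      by (simp only:)
    also have "\<dots> = of_nat n * of_nat n powr (- (z + 1) - 1)"
      using False by (subst powr_add) simp
    finally show ?thesis using False by (simp add: e_def)
  qed (simp add: e_def)
  let ?W = "{z. z + 1 \<in> {s. Re s > 0 \<and> Zeta_reg s \<noteq> 0}}"
  have "(\<lambda>N. Dirichlet_psum e N 0) \<longlonglongrightarrow> psi_continuation (0 + 1)"
  proof (rule Newman_tauberian[where D = "\<lambda>z. psi_continuation (z + 1)", OF e])
    show "(\<lambda>n. e n * of_nat n powr (- z - 1)) sums psi_continuation (z + 1)" if "Re z > 0" for z
    proof -
      have z: "Re (z + 1) > 1" using that by simp
      show ?thesis unfolding eq psi_continuation_eq[OF z] by (rule psi_err_sums[OF z])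
    qed
    show "open ?W"
      using open_vimage[OF open_Zeta_reg_nonzero, of "\<lambda>z. z + 1"] by (simp add: vimage_def continuous_intros)
    show "{z. Re z \<ge> 0} \<subseteq> ?W"
      by (auto intro!: Zeta_reg_nonzero)
    have "psi_continuation \<circ> (\<lambda>z. z + 1) holomorphic_on ?W"
      by (rule holomorphic_on_compose_gen[OF _ holomorphic_psi_continuation]) (auto intro!: holomorphic_intros)
    then show "(\<lambda>z. psi_continuation (z + 1)) holomorphic_on ?W"
      by (simp add: o_def)
  qed
  then have "(\<lambda>n. e n * of_nat n powr (- 0 - 1)) sums psi_continuation (0 + 1)"
    by (simp add: sums_def_le Dirichlet_psum_def)
  moreover have "e n * of_nat n powr (- 0 - 1) = of_real ((psi n - real n) / real n ^ 2)" for n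
    by (cases "n = 0") (simp_all add: e_def psi_err_def powr_minus field_simps power2_eq_square)
  ultimately have "summable (\<lambda>n. complex_of_real ((psi n - real n) / real n ^ 2))"
    by (simp only: sums_iff)
  then show ?thesis by (simp only: summable_complex_of_real)
qed

theorem theorem2p9:
  shows "(\<lambda>N::nat. (1 / real N) * (\<Sum>n = 1..N. (mangoldt n :: real))) \<longlonglongrightarrow> 1"
  using mono_Cesaro_tendsto[OF mono_psi summable_psi_minus_id] by (simp add: psi_def)

end
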